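(* Let $a_{1}, \cdots, a_{r}, b_{1}, \cdots, b_{r}$ be positive integers, and let $f$ and $n$ be odd positive integers. Then \[ E^{(r)}_{n,\chi,q}(a_{1},\cdots,a_{r};b_{1},\cdots,b_{r}) = f^{n}\sum_{n_{1},\cdots,n_{r}=0}^{f-1}(-1)^{\sum_{j=1}^{r}n_{j}}\prod_{j=1}^{r}\chi(n_{j})\, q^{\sum_{j=1}^{r}b_{j}n_{j}}\; E^{(r)}_{n,q^{f}}\Big(\tfrac{a_{1}n_{1}+\cdots+a_{r}n_{r}}{f}\,\Big|\,a_{1},\cdots,a_{r};b_{1},\cdots,b_{r}\Big). \]
   Context: Let $p$ be a fixed odd prime, $\mathbb{Z}_p$ the $p$-adic integers, $\mathbb{C}_p$ the completion of the algebraic closure of $\mathbb{Q}_p$, and let $q\in\mathbb{C}_p$ with $|q-1|_p<p^{-1/(p-1)}$, so $q^{x}=\exp(x\log q)$ for $x\in\mathbb{Z}_p$. The fermionic $p$-adic integral is $\int_{\mathbb{Z}_p} g(y)\,d\mu_{-1}(y)=\lim_{N\to\infty}\sum_{y=0}^{p^N-1} g(y)(-1)^{y}$. For positive integers $a_1,\dots,a_r,b_1,\dots,b_r$ the multivariate $q$-Euler polynomials of order $r$ are defined by $E^{(r)}_{n,q}(x\,|\,a_1,\dots,a_r;b_1,\dots,b_r)=\int_{\mathbb{Z}_p}\cdots\int_{\mathbb{Z}_p} q^{b_1x_1+\cdots+b_rx_r}(x+a_1x_1+\cdots+a_rx_r)^{n}\,d\mu_{-1}(x_1)\cdots d\mu_{-1}(x_r)$,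 with generating function $\sum_{n\ge0}E^{(r)}_{n,q}(x|a;b)\frac{t^n}{n!}=\frac{2^{r}e^{xt}}{\prod_{j=1}^{r}(q^{b_j}e^{a_jt}+1)}$. Let $\chi$ be a Dirichlet character with odd conductor $f\in\mathbb{N}$, and $X=\varprojlim_N \mathbb{Z}/fp^N\mathbb{Z}$. The multivariate generalized $q$-Euler numbers attached to $\chi$ are $E^{(r)}_{n,\chi,q}(a_1,\dots,a_r;b_1,\dots,b_r)=\int_X\cdots\int_X \chi(x_1)\cdots\chi(x_r)\,q^{b_1x_1+\cdots+b_rx_r}(a_1x_1+\cdots+a_rx_r)^{n}\,d\mu_{-1}(x_1)\cdots d\mu_{-1}(x_r)$. *)

theory Defs
  imports "HOL-Analysis.Analysis" "HOL-Number_Theory.Number_Theory"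
begin

class nonarch_field = field_char_0 + metric_space +
  fixes vabs :: "'a \<Rightarrow> real"
  assumes dist_vabs: "dist x y = vabs (x - y)"
    and vabs_mult: "vabs (x * y) = vabs x * vabs y"
    and vabs_add: "vabs (x + y) \<le> max (vabs x) (vabs y)"

text \<open>In a complete field whose absolute value restricts to the $p$-adic one on the integers,
  the closure of \<open>\<rat>\<close> is the completion of \<open>\<rat>\<close>, i.e. the field of $p$-adic numbers.\<close>

definition Qp :: "'a::nonarch_field set" where
  "Qp = closure \<rat>"

definition Qp_alg :: "'a::nonarch_field set" where
  "Qp_alg = {x. \<exists>P. P \<noteq> 0 \<and> (\<forall>i. poly.coeff P i \<in> Qp) \<and> poly P x = 0}"

text \<open>The type \<open>'a\<close> is a completion of an algebraic closure of the $p$-adic numbers.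
  This determines \<open>'a\<close> up to isometric isomorphism. It is a predicate on a type because
  no single type can depend on the number \<open>p\<close>.\<close>

definition is_Cp :: "nat \<Rightarrow> 'a::nonarch_field itself \<Rightarrow> bool" where
  "is_Cp p T \<longleftrightarrow>
     (\<forall>z::int. z \<noteq> 0 \<longrightarrow> vabs (of_int z :: 'a) = 1 / real p ^ multiplicity (int p) z) \<and>
     (\<forall>P::'a poly. 0 < degree P \<and> (\<forall>i. poly.coeff P i \<in> Qp_alg) \<longrightarrow> (\<exists>x\<in>Qp_alg. poly P x = 0)) \<and>
     closure (Qp_alg :: 'a set) = UNIV \<and>
     complete (UNIV :: 'a set)"

definition padic_exp :: "'a::nonarch_field \<Rightarrow> 'a" where
  "padic_exp z = (\<Sum>k. z ^ k / fact k)"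

definition padic_log :: "'a::nonarch_field \<Rightarrow> 'a" where
  "padic_log u = (\<Sum>k. (-1) ^ k * (u - 1) ^ Suc k / of_nat (Suc k))"

definition qpow :: "'a::nonarch_field \<Rightarrow> 'a \<Rightarrow> 'a" where
  "qpow q x = padic_exp (x * padic_log q)"

definition fermionic_integral :: "nat \<Rightarrow> ('a::nonarch_field \<Rightarrow> 'a) \<Rightarrow> 'a" where
  "fermionic_integral p g = lim (\<lambda>N. \<Sum>y<p ^ N. g (of_nat y) * (-1) ^ y)"

text \<open>Elements of the inverse limit \<open>X\<close> of the rings of integers modulo \<open>f * p ^ N\<close> are coherent
  sequences of least residues.\<close>

definition inv_limit :: "nat \<Rightarrow> nat \<Rightarrow> (nat \<Rightarrow> nat) set" where
  "inv_limit p f = {x. \<forall>N. x N < f * p ^ N \<and> x (Suc N) mod (f * p ^ N) = x N}"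

definition X_of_nat :: "nat \<Rightarrow> nat \<Rightarrow> nat \<Rightarrow> (nat \<Rightarrow> nat)" where
  "X_of_nat p f y = (\<lambda>N. y mod (f * p ^ N))"

lemma X_of_nat_in_inv_limit:
  assumes "0 < p" "0 < f"
  shows "X_of_nat p f y \<in> inv_limit p f"
  using assms by (auto simp: X_of_nat_def inv_limit_def mod_mod_cancel)

text \<open>The canonical projection from \<open>X\<close> to the $p$-adic integers.\<close>

definition X_to_Zp :: "(nat \<Rightarrow> nat) \<Rightarrow> 'a::nonarch_field" where
  "X_to_Zp x = lim (\<lambda>N. of_nat (x N))"

text \<open>A character modulo \<open>f\<close> acts on \<open>X\<close> through the projection to the integers modulo \<open>f\<close>,
  which is the component \<open>N = 0\<close>.\<close>

definition X_char :: "(int \<Rightarrow> 'a) \<Rightarrow> (nat \<Rightarrow> nat) \<Rightarrow> 'a" where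
  "X_char chi x = chi (int (x 0))"

definition fermionic_integral_X ::
    "nat \<Rightarrow> nat \<Rightarrow> ((nat \<Rightarrow> nat) \<Rightarrow> 'a::nonarch_field) \<Rightarrow> 'a" where
  "fermionic_integral_X p f g = lim (\<lambda>N. \<Sum>y<f * p ^ N. g (X_of_nat p f y) * (-1) ^ y)"

text \<open>Iterated integral over \<open>x 1, \<dots>, x r\<close>, with \<open>x 1\<close> innermost; the integrand is
  only meant to depend on these coordinates.\<close>

primrec iterated_integral :: "(('x \<Rightarrow> 'a) \<Rightarrow> 'a) \<Rightarrow> nat \<Rightarrow> ((nat \<Rightarrow> 'x) \<Rightarrow> 'a) \<Rightarrow> 'a" where
  "iterated_integral I 0 G = G (\<lambda>_. undefined)"
| "iterated_integral I (Suc r) G =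
     I (\<lambda>y. iterated_integral I r (\<lambda>x. G (x(Suc r := y))))"

definition q_Euler_poly ::
    "nat \<Rightarrow> 'a::nonarch_field \<Rightarrow> nat \<Rightarrow> (nat \<Rightarrow> nat) \<Rightarrow> (nat \<Rightarrow> nat) \<Rightarrow> nat \<Rightarrow> 'a \<Rightarrow> 'a" where
  "q_Euler_poly p q r a b n x =
     iterated_integral (fermionic_integral p) r
       (\<lambda>y. qpow q (\<Sum>j=1..r. of_nat (b j) * y j) * (x + (\<Sum>j=1..r. of_nat (a j) * y j)) ^ n)"

definition gen_q_Euler_number ::
    "nat \<Rightarrow> nat \<Rightarrow> (int \<Rightarrow> 'a::nonarch_field) \<Rightarrow> 'a \<Rightarrow> nat \<Rightarrow> (nat \<Rightarrow> nat) \<Rightarrow> (nat \<Rightarrow> nat) \<Rightarrow> nat \<Rightarrow> 'a" where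
  "gen_q_Euler_number p f chi q r a b n =
     iterated_integral (fermionic_integral_X p f) r
       (\<lambda>x. (\<Prod>j=1..r. X_char chi (x j)) *
            qpow q (\<Sum>j=1..r. of_nat (b j) * X_to_Zp (x j)) *
            (\<Sum>j=1..r. of_nat (a j) * X_to_Zp (x j)) ^ n)"

definition dirichlet_character :: "nat \<Rightarrow> (int \<Rightarrow> 'a::field) \<Rightarrow> bool" where
  "dirichlet_character f chi \<longleftrightarrow>
     0 < f \<and> chi 1 = 1 \<and> (\<forall>k l. chi (k * l) = chi k * chi l) \<and>
     (\<forall>k. chi (k + int f) = chi k) \<and> (\<forall>k. chi k = 0 \<longleftrightarrow> \<not> coprime k (int f))"

definition conductor :: "nat \<Rightarrow> (int \<Rightarrow> 'a::field) \<Rightarrow> nat" where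
  "conductor f chi = (LEAST d. 0 < d \<and> d dvd f \<and>
     (\<forall>k l. coprime k (int f) \<and> coprime l (int f) \<and> [k = l] (mod int d) \<longrightarrow> chi k = chi l))"

end

theory Submission imports Defs begin

text \<open>
  The integrands are only ever evaluated at natural numbers, where \<open>q\<^sup>x\<close> is an ordinary power: expanding
  \<open>exp (k log (1 + t))\<close> as a double series and exchanging the two summations leaves the coefficients
  of the formal identity \<open>exp (k ln (1 + X)) = (1 + X) ^ k\<close>. So both sides are iterated limits of
  alternating sums over \<open>y < f p\<^sup>N\<close> and \<open>y < p\<^sup>N\<close>. Writing \<open>y = m + f z\<close> with \<open>m < f\<close> and
  \<open>z < p\<^sup>N\<close>, oddness of \<open>f\<close> gives \<open>(-1)\<^sup>y = (-1)\<^sup>m (-1)\<^sup>z\<close>, the character depends on \<open>m\<close> only, and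
  \<open>f\<^sup>n\<close> comes out of the \<open>n\<close>-th power. The limits exist and may be exchanged with finite sums because,
  for fixed \<open>m\<close>, the integrand is uniformly continuous in \<open>z\<close> for the $p$-adic metric; by the
  ultrametric inequality integration over one variable preserves uniform continuity in the others.
\<close>

section \<open>Ultrametric fields\<close>

lemma vabs_nonneg [simp]: "0 \<le> vabs (x :: 'a::nonarch_field)"
  using dist_vabs[of x 0] zero_le_dist[of x 0] by simp

lemma vabs_eq_0_iff [simp]: "vabs (x :: 'a::nonarch_field) = 0 \<longleftrightarrow> x = 0"
  using dist_vabs[of x 0] dist_eq_0_iff[of x 0] by simp

lemma vabs_zero [simp]: "vabs (0 :: 'a::nonarch_field) = 0"
  by simp

lemma vabs_one [simp]: "vabs (1 :: 'a::nonarch_field) = 1"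
proof -
  have "vabs (1::'a) * vabs (1::'a) = vabs (1::'a)"
    by (metis mult_1 vabs_mult)
  moreover have "vabs (1::'a) \<noteq> 0"
    by (simp del: vabs_zero)
  ultimately show ?thesis by simp
qed

lemma vabs_minus [simp]: "vabs (- x) = vabs (x :: 'a::nonarch_field)"
  using dist_commute[of x 0] by (simp add: dist_vabs)

lemma vabs_minus_commute: "vabs (x - y) = vabs (y - x :: 'a::nonarch_field)"
  using dist_commute[of x y] by (simp add: dist_vabs)

lemma vabs_power: "vabs (x ^ n) = vabs (x :: 'a::nonarch_field) ^ n"
  by (induction n) (simp_all add: vabs_mult)

lemma vabs_divide: "vabs (x / y) = vabs x / vabs (y :: 'a::nonarch_field)"
proof (cases "y = 0")
  case False
  then have "vabs (x / y) * vabs y = vabs x"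
    by (simp flip: vabs_mult)
  with False show ?thesis
    by (metis nonzero_mult_div_cancel_right vabs_eq_0_iff)
qed simp

lemma vabs_neg_one_power [simp]: "vabs ((- 1) ^ n :: 'a::nonarch_field) = 1"
  by (simp add: vabs_power)

lemma vabs_add_le: "vabs x \<le> e \<Longrightarrow> vabs y \<le> e \<Longrightarrow> vabs (x + y :: 'a::nonarch_field) \<le> e"
  using vabs_add[of x y] by simp

lemma vabs_le_1_near_1:
  fixes q :: "'a::nonarch_field"
  assumes "vabs (q - 1) \<le> 1"
  shows "vabs q \<le> 1"
  using vabs_add_le[of "q - 1" 1 1] assms by simp

lemma vabs_sum_le:
  fixes f :: "'i \<Rightarrow> 'a::nonarch_field"
  assumes "0 \<le> e" and "\<And>i. i \<in> A \<Longrightarrow> vabs (f i) \<le> e"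
  shows "vabs (sum f A) \<le> e"
  using assms(2) by (induction A rule: infinite_finite_induct) (simp_all add: assms(1) vabs_add_le)

lemma vabs_diff_mult_le:
  fixes x y x' y' :: "'a::nonarch_field"
  assumes "vabs x \<le> B" "vabs y' \<le> C" "vabs (x - x') * C \<le> e" "B * vabs (y - y') \<le> e"
  shows "vabs (x * y - x' * y') \<le> e"
proof -
  have "x * y - x' * y' = x * (y - y') + (x - x') * y'"
    by (simp add: algebra_simps)
  moreover have "vabs (x * (y - y')) \<le> e"
    using mult_right_mono[OF assms(1), of "vabs (y - y')"] assms(4) by (simp add: vabs_mult)
  moreover have "vabs ((x - x') * y') \<le> e"
    using mult_left_mono[OF assms(2), of "vabs (x - x')"] assms(3) by (simp add: vabs_mult)
  ultimately show ?thesis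
    by (simp add: vabs_add_le)
qed

section \<open>Continuity of the field operations in the metric topology\<close>

lemma tendsto_vabs_iff:
  "(f \<longlongrightarrow> (l :: 'a::nonarch_field)) F \<longleftrightarrow> ((\<lambda>x. vabs (f x - l)) \<longlongrightarrow> 0) F"
  using tendsto_dist_iff[of f l F] by (simp add: dist_vabs)

lemma tendsto_vabs:
  assumes "(f \<longlongrightarrow> (l :: 'a::nonarch_field)) F"
  shows "((\<lambda>x. vabs (f x)) \<longlongrightarrow> vabs l) F"
  using tendsto_dist[OF assms tendsto_const[of 0]] by (simp add: dist_vabs)

text \<open>The class provides only a metric; this instance and the next make the general limit
  rules for sums and products available.\<close>

instance nonarch_field < topological_ab_group_add
proof
  fix a b :: 'a
  have "((\<lambda>x. vabs (fst x - a) + vabs (snd x - b)) \<longlongrightarrow> 0) (nhds a \<times>\<^sub>F nhds b)"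
    using tendsto_fst[OF filterlim_ident, of "(a, b)"] tendsto_snd[OF filterlim_ident, of "(a, b)"]
    by (intro tendsto_add_zero) (simp_all flip: nhds_prod tendsto_vabs_iff)
  moreover have "vabs (fst x + snd x - (a + b)) \<le> vabs (fst x - a) + vabs (snd x - b)" for x :: "'a \<times> 'a"
  proof -
    have "vabs (fst x + snd x - (a + b)) \<le> max (vabs (fst x - a)) (vabs (snd x - b))"
      using vabs_add[of "fst x - a" "snd x - b"] by (simp add: algebra_simps)
    also have "\<dots> \<le> vabs (fst x - a) + vabs (snd x - b)"
      by simp
    finally show ?thesis .
  qed
  ultimately show "((\<lambda>x. fst x + snd x) \<longlongrightarrow> a + b) (nhds a \<times>\<^sub>F nhds b)"
    unfolding tendsto_vabs_iff by (rule_tac tendsto_0_le[where K = 1]) auto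
  show "(uminus \<longlongrightarrow> - a) (nhds a)"
    using filterlim_ident[of "nhds a"] unfolding tendsto_vabs_iff
    by (simp add: vabs_minus_commute)
qed

instance nonarch_field < topological_comm_monoid_mult
proof
  fix a b :: 'a
  let ?F = "nhds a \<times>\<^sub>F nhds b"
  have fst: "((\<lambda>x. vabs (fst x - a)) \<longlongrightarrow> 0) ?F"
    and snd: "((\<lambda>x. vabs (snd x - b)) \<longlongrightarrow> 0) ?F"
    using tendsto_fst[OF filterlim_ident, of "(a, b)"] tendsto_snd[OF filterlim_ident, of "(a, b)"]
    by (simp_all flip: nhds_prod tendsto_vabs_iff)
  have "((\<lambda>x. vabs a * vabs (snd x - b) + vabs (fst x - a) * vabs (snd x)) \<longlongrightarrow>
      vabs a * 0 + 0 * vabs b) ?F"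
    using snd by (intro tendsto_intros fst snd tendsto_vabs) (simp add: tendsto_vabs_iff)
  moreover have "vabs (fst x * snd x - a * b) \<le>
      vabs a * vabs (snd x - b) + vabs (fst x - a) * vabs (snd x)" for x :: "'a \<times> 'a"
  proof -
    have "fst x * snd x - a * b = a * (snd x - b) + (fst x - a) * snd x"
      by (simp add: algebra_simps)
    then have "vabs (fst x * snd x - a * b) \<le> max (vabs (a * (snd x - b))) (vabs ((fst x - a) * snd x))"
      using vabs_add[of "a * (snd x - b)" "(fst x - a) * snd x"] by simp
    also have "\<dots> \<le> vabs (a * (snd x - b)) + vabs ((fst x - a) * snd x)"
      by simp
    finally show ?thesis by (simp add: vabs_mult)
  qed
  ultimately show "((\<lambda>x. fst x * snd x) \<longlongrightarrow> a * b) ?F"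
    unfolding tendsto_vabs_iff by (rule_tac tendsto_0_le[where K = 1]) auto
qed

section \<open>Convergence of sequences, series and double series\<close>

lemma vabs_lim_le:
  fixes X :: "nat \<Rightarrow> 'a::nonarch_field"
  assumes "X \<longlonglongrightarrow> l" and "\<And>n. N \<le> n \<Longrightarrow> vabs (X n) \<le> e"
  shows "vabs l \<le> e"
  using LIMSEQ_le_const2[OF tendsto_vabs[OF assms(1)]] assms(2) by blast

text \<open>By the ultrametric inequality the distance between two terms is at most the largest
  consecutive step between them, so null steps already give a Cauchy sequence. Both the convergence
  of series and the existence of the integrals rest on this.\<close>

lemma convergent_if_diff_null:
  fixes X :: "nat \<Rightarrow> 'a::nonarch_field"
  assumes complete: "complete (UNIV :: 'a set)" and null: "(\<lambda>n. X (Suc n) - X n) \<longlonglongrightarrow> 0"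
  shows "convergent X"
proof -
  have "\<exists>N. \<forall>n\<ge>N. dist (X n) (X N) < e" if "0 < e" for e
  proof -
    from null that obtain N where N: "\<And>n. N \<le> n \<Longrightarrow> vabs (X (Suc n) - X n) < e"
      by (force simp: lim_sequentially dist_vabs)
    have "vabs (X (N + k) - X N) < e" for k
    proof (induction k)
      case (Suc k)
      have "X (N + Suc k) - X N = (X (Suc (N + k)) - X (N + k)) + (X (N + k) - X N)"
        by simp
      then show ?case
        using vabs_add[of "X (Suc (N + k)) - X (N + k)" "X (N + k) - X N"] N[of "N + k"] Suc
        by simp
    qed (use that in simp)
    then show ?thesis
      by (metis dist_vabs le_iff_add)
  qed
  then have "Cauchy X"
    by (simp add: Cauchy_altdef2)
  then show ?thesis
    using complete by (auto simp: complete_def convergent_def)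
qed

lemma nonarch_summable:
  fixes f :: "nat \<Rightarrow> 'a::nonarch_field"
  assumes "complete (UNIV :: 'a set)" "f \<longlonglongrightarrow> 0"
  shows "summable f"
  unfolding summable_iff_convergent using assms by (intro convergent_if_diff_null) simp_all

text \<open>A finite block of a tail is no larger than its largest term, and this bound survives the
  limit. With \<open>N = 0\<close> it bounds the whole sum.\<close>

lemma vabs_suminf_tail_le:
  fixes f :: "nat \<Rightarrow> 'a::nonarch_field"
  assumes "summable f" "0 \<le> e" "\<And>n. N \<le> n \<Longrightarrow> vabs (f n) \<le> e"
  shows "vabs (suminf f - (\<Sum>n<N. f n)) \<le> e"
proof (rule vabs_lim_le)
  show "(\<lambda>M. (\<Sum>n<M. f n) - (\<Sum>n<N. f n)) \<longlonglongrightarrow> suminf f - (\<Sum>n<N. f n)"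
    using summable_LIMSEQ[OF assms(1)] by (intro tendsto_intros)
  show "vabs ((\<Sum>n<M. f n) - (\<Sum>n<N. f n)) \<le> e" if "N \<le> M" for M
  proof -
    have "(\<Sum>n<M. f n) - (\<Sum>n<N. f n) = (\<Sum>n=N..<M. f n)"
      using sum_diff_nat_ivl[of 0 N M f] that by (simp add: lessThan_atLeast0)
    then show ?thesis
      using vabs_sum_le[OF assms(2), of "{N..<M}" f] assms(3) by simp
  qed
qed

text \<open>For each \<open>e\<close> all entries outside some finite square are at most
  \<open>e\<close>: the ultrametric substitute for absolute summability of a double series.\<close>

definition null_family :: "(nat \<Rightarrow> nat \<Rightarrow> 'a::nonarch_field) \<Rightarrow> bool" where
  "null_family c \<longleftrightarrow> (\<forall>e>0. \<exists>N. \<forall>i j. N \<le> i \<or> N \<le> j \<longrightarrow> vabs (c i j) \<le> e)"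

lemma null_family_swap: "null_family c \<Longrightarrow> null_family (\<lambda>i j. c j i)"
  unfolding null_family_def by meson

lemma null_family_summable:
  fixes c :: "nat \<Rightarrow> nat \<Rightarrow> 'a::nonarch_field"
  assumes "complete (UNIV :: 'a set)" "null_family c"
  shows "summable (c i)"
proof (rule nonarch_summable[OF assms(1)])
  have "\<exists>N. \<forall>n\<ge>N. vabs (c i n) < e" if "0 < e" for e
  proof -
    from that have "0 < e / 2" by simp
    then obtain N where "\<forall>i j. N \<le> i \<or> N \<le> j \<longrightarrow> vabs (c i j) \<le> e / 2"
      using assms(2) unfolding null_family_def by blast
    then have "vabs (c i n) \<le> e / 2" if "N \<le> n" for n
      using that by blast
    then have "vabs (c i n) < e" if "N \<le> n" for n
      using order_le_less_trans[of "vabs (c i n)" "e / 2" e] that \<open>0 < e\<close> by simp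
    then show ?thesis by blast
  qed
  then show "c i \<longlonglongrightarrow> 0"
    by (simp add: lim_sequentially dist_vabs)
qed

text \<open>Truncating to a square of side \<open>N\<close> changes each row sum by a small tail,
  and the ultrametric inequality keeps the total error small however many rows there are.\<close>

lemma null_family_square_sums:
  fixes c :: "nat \<Rightarrow> nat \<Rightarrow> 'a::nonarch_field"
  assumes complete: "complete (UNIV :: 'a set)" and null: "null_family c"
  shows "summable (\<lambda>i. suminf (c i))"
    and "(\<lambda>N. \<Sum>i<N. \<Sum>j<N. c i j) \<longlonglongrightarrow> (\<Sum>i. suminf (c i))"
proof -
  note row = null_family_summable[OF complete null]
  have tail: "\<exists>N. (\<forall>i\<ge>N. vabs (suminf (c i)) < e) \<and>
      (\<forall>n\<ge>N. vabs ((\<Sum>i<n. \<Sum>j<n. c i j) - (\<Sum>i<n. suminf (c i))) < e)" if "0 < e" for e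
  proof -
    from that have "0 < e / 2" by simp
    then obtain N where N: "\<And>i j. N \<le> i \<or> N \<le> j \<Longrightarrow> vabs (c i j) \<le> e / 2"
      using null unfolding null_family_def by blast
    have "vabs (suminf (c i)) < e" if "N \<le> i" for i
      using vabs_suminf_tail_le[OF row, of "e / 2" 0 i] N that \<open>0 < e\<close> by simp
    moreover have "vabs ((\<Sum>i<n. \<Sum>j<n. c i j) - (\<Sum>i<n. suminf (c i))) < e" if "N \<le> n" for n
    proof -
      have "vabs (\<Sum>i<n. (\<Sum>j<n. c i j) - suminf (c i)) \<le> e / 2"
      proof (rule vabs_sum_le)
        show "vabs ((\<Sum>j<n. c i j) - suminf (c i)) \<le> e / 2" for i
          using vabs_suminf_tail_le[OF row, of "e / 2" n i] N that \<open>0 < e\<close>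
          by (simp add: vabs_minus_commute)
      qed (use \<open>0 < e\<close> in simp)
      then show ?thesis
        using \<open>0 < e\<close> by (simp add: sum_subtractf)
    qed
    ultimately show ?thesis by blast
  qed
  have "(\<lambda>i. suminf (c i)) \<longlonglongrightarrow> 0"
    using tail unfolding lim_sequentially dist_vabs by fastforce
  then show summable: "summable (\<lambda>i. suminf (c i))"
    by (rule nonarch_summable[OF complete])
  have "(\<lambda>N. (\<Sum>i<N. \<Sum>j<N. c i j) - (\<Sum>i<N. suminf (c i))) \<longlonglongrightarrow> 0"
    using tail unfolding lim_sequentially dist_vabs by fastforce
  from tendsto_add[OF this summable_LIMSEQ[OF summable]]
  show "(\<lambda>N. \<Sum>i<N. \<Sum>j<N. c i j) \<longlonglongrightarrow> (\<Sum>i. suminf (c i))"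
    by simp
qed

text \<open>The square partial sums of \<open>c\<close> and of its transpose are the same finite
  sums, so both iterated sums are limits of one sequence.\<close>

lemma null_family_suminf_swap:
  fixes c :: "nat \<Rightarrow> nat \<Rightarrow> 'a::nonarch_field"
  assumes "complete (UNIV :: 'a set)" "null_family c"
  shows "(\<Sum>i. \<Sum>j. c i j) = (\<Sum>j. \<Sum>i. c i j)"
proof -
  have "(\<lambda>N. \<Sum>i<N. \<Sum>j<N. c j i) = (\<lambda>N. \<Sum>i<N. \<Sum>j<N. c i j)"
    by (rule ext, rule sum.swap)
  then show ?thesis
    using null_family_square_sums(2)[OF assms]
      null_family_square_sums(2)[OF assms(1) null_family_swap[OF assms(2)]]
    by (metis LIMSEQ_unique)
qed

lemma nonarch_sums_mult:
  fixes f :: "nat \<Rightarrow> 'a::nonarch_field"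
  shows "f sums s \<Longrightarrow> (\<lambda>n. c * f n) sums (c * s)"
  unfolding sums_def by (simp add: tendsto_mult_left flip: sum_distrib_left)

lemma nonarch_sums_shift:
  fixes f :: "nat \<Rightarrow> 'a::nonarch_field"
  assumes "f sums s"
  shows "(\<lambda>n. if i \<le> n then f (n - i) else 0) sums s"
proof -
  have "(\<Sum>n<N + i. if i \<le> n then f (n - i) else 0) = (\<Sum>n<N. f n)" for N
    by (induction N) (simp_all add: sum.neutral)
  then show ?thesis
    using assms unfolding sums_def
    by (rule_tac LIMSEQ_offset[where k = i]) simp
qed

lemma null_seq_geometric:
  fixes h :: "nat \<Rightarrow> 'a::nonarch_field"
  assumes "\<And>n. vabs (h n) \<le> D * x ^ n" "0 \<le> x" "x < 1"
  shows "h \<longlonglongrightarrow> 0"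
proof -
  have "(\<lambda>n. D * x ^ n) \<longlonglongrightarrow> D * 0"
    using assms(2,3) by (intro tendsto_intros LIMSEQ_power_zero) simp
  then show ?thesis
    unfolding tendsto_vabs_iff using assms(1)
    by (rule_tac tendsto_sandwich[of "\<lambda>_. 0" _ _ "\<lambda>n. D * x ^ n"]) auto
qed

text \<open>The products are arranged in a triangular array whose rows sum to
  \<open>f i * suminf g\<close> and whose columns sum to the convolution. The common ratio
  \<open>x\<close> bounds column \<open>n\<close> independently of the row.\<close>

lemma nonarch_Cauchy_product:
  fixes f g :: "nat \<Rightarrow> 'a::nonarch_field"
  assumes complete: "complete (UNIV :: 'a set)"
    and f: "\<And>n. vabs (f n) \<le> B * x ^ n" and g: "\<And>n. vabs (g n) \<le> C * x ^ n"
    and x: "0 \<le> x" "x < 1"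
  shows "suminf f * suminf g = (\<Sum>n. \<Sum>i=0..n. f i * g (n - i))"
proof -
  define c where "c i n = (if i \<le> n then f i * g (n - i) else 0)" for i n
  have "0 \<le> B" "0 \<le> C"
    using order_trans[OF vabs_nonneg f[of 0]] order_trans[OF vabs_nonneg g[of 0]] by simp_all
  have bound: "vabs (c i n) \<le> B * C * x ^ n" for i n
  proof (cases "i \<le> n")
    case True
    have "vabs (f i) * vabs (g (n - i)) \<le> (B * x ^ i) * (C * x ^ (n - i))"
      using f g \<open>0 \<le> B\<close> x by (intro mult_mono) auto
    also have "\<dots> = B * C * x ^ n"
      using True by (simp flip: power_add add: mult_ac)
    finally show ?thesis
      using True by (simp add: c_def vabs_mult)
  qed (simp add: c_def \<open>0 \<le> B\<close> \<open>0 \<le> C\<close> x)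
  have null: "null_family c"
    unfolding null_family_def
  proof (intro allI impI)
    fix e :: real assume "0 < e"
    have "(\<lambda>n. B * C * x ^ n) \<longlonglongrightarrow> B * C * 0"
      using x by (intro tendsto_intros LIMSEQ_power_zero) simp
    then obtain N where N: "\<And>n. N \<le> n \<Longrightarrow> B * C * x ^ n < e"
      using \<open>0 < e\<close> order_tendstoD(2)[of _ "B * C * 0" _ e]
      by (force simp: eventually_sequentially)
    have "vabs (c i n) \<le> e" if "N \<le> i \<or> N \<le> n" for i n
    proof (cases "N \<le> n")
      case True
      then show ?thesis using bound[of i n] N[of n] by simp
    next
      \<comment> \<open>Here \<open>n < N \<le> i\<close>, so the entry lies outside the triangle
        and is 0.\<close>
      case False
      then show ?thesis using that \<open>0 < e\<close> by (simp add: c_def)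
    qed
    then show "\<exists>N. \<forall>i j. N \<le> i \<or> N \<le> j \<longrightarrow> vabs (c i j) \<le> e" by blast
  qed
  have sf: "f sums suminf f" and sg: "g sums suminf g"
    using nonarch_summable[OF complete] null_seq_geometric[OF f x] null_seq_geometric[OF g x]
    by blast+
  have "c i sums (f i * suminf g)" for i
  proof -
    have "(\<lambda>n. f i * (if i \<le> n then g (n - i) else 0)) = c i"
      by (auto simp: c_def)
    then show ?thesis
      using nonarch_sums_mult[OF nonarch_sums_shift[OF sg, of i], of "f i"] by simp
  qed
  then have "(\<Sum>i. suminf (c i)) = (\<Sum>i. f i * suminf g)"
    by (simp add: sums_iff)
  also have "\<dots> = suminf f * suminf g"
    using nonarch_sums_mult[OF sf, of "suminf g"] by (simp add: sums_iff mult.commute)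
  finally have "suminf f * suminf g = (\<Sum>n. \<Sum>i. c i n)"
    using null_family_suminf_swap[OF complete null] by simp
  moreover have "(\<Sum>i. c i n) = (\<Sum>i=0..n. f i * g (n - i))" for n
    by (subst suminf_finite[of "{0..n}"]) (auto simp: c_def)
  ultimately show ?thesis by simp
qed

section \<open>The $p$-adic exponential and logarithm\<close>

lemma multiplicity_int_int: "multiplicity (int p) (int n) = multiplicity p n"
  by (simp add: multiplicity_def flip: of_nat_power)

text \<open>The additional factors \<open>p * m + 1\<close>, ..., \<open>p * m + r\<close> are prime
  to \<open>p\<close> because \<open>r < p\<close>.\<close>

lemma prime_multiplicity_fact_add:
  assumes "prime p" "r < p"
  shows "multiplicity p (fact (p * m + r) :: nat) = multiplicity p (fact (p * m) :: nat)"
  using assms(2)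
proof (induction r)
  case (Suc r)
  have "(p * m + Suc r) mod p = Suc r"
    using Suc.prems by simp
  then have "\<not> p dvd p * m + Suc r"
    by (metis dvd_eq_mod_eq_0 nat.distinct(1))
  then have "multiplicity p (p * m + Suc r) = 0"
    by (rule not_dvd_imp_multiplicity_0)
  moreover have "fact (p * m + Suc r) = (p * m + Suc r) * (fact (p * m + r) :: nat)"
    by simp
  ultimately have "multiplicity p (fact (p * m + Suc r) :: nat) = multiplicity p (fact (p * m + r) :: nat)"
    using prime_elem_multiplicity_mult_distrib[of p "p * m + Suc r" "fact (p * m + r)"] assms(1)
    by (simp del: fact_Suc)
  with Suc show ?case by simp
qed simp

text \<open>Of the \<open>p\<close> new factors in the induction step only \<open>p * Suc m\<close>
  is divisible by \<open>p\<close>; it contributes 1 plus the multiplicity of \<open>p\<close> in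
  \<open>Suc m\<close>.\<close>

lemma prime_multiplicity_fact_mult:
  assumes "prime p"
  shows "multiplicity p (fact (p * m) :: nat) = m + multiplicity p (fact m :: nat)"
proof (induction m)
  case (Suc m)
  have pos: "0 < p"
    using assms by (rule prime_gt_0_nat)
  then have "p * Suc m = Suc (p * m + (p - 1))"
    by simp
  then have "fact (p * Suc m) = (p * Suc m) * (fact (p * m + (p - 1)) :: nat)"
    by (metis fact_Suc of_nat_id)
  then have "multiplicity p (fact (p * Suc m) :: nat) =
      multiplicity p p + multiplicity p (Suc m) + multiplicity p (fact (p * m + (p - 1)) :: nat)"
    using pos assms prime_elem_multiplicity_mult_distrib[of p "p * Suc m" "fact (p * m + (p - 1))"]
      prime_elem_multiplicity_mult_distrib[of p p "Suc m"] by (simp del: fact_Suc mult_Suc_right)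
  also have "multiplicity p p = 1"
    using assms by (simp add: prime_gt_0_nat)
  also have "multiplicity p (fact (p * m + (p - 1)) :: nat) = m + multiplicity p (fact m :: nat)"
    using Suc prime_multiplicity_fact_add[OF assms, of "p - 1" m] pos by simp
  also have "1 + multiplicity p (Suc m) + (m + multiplicity p (fact m :: nat)) =
      Suc m + multiplicity p (fact (Suc m) :: nat)"
    using prime_elem_multiplicity_mult_distrib[of p "Suc m" "fact m"] assms by simp
  finally show ?case .
qed simp

text \<open>Legendre's bound, by recursion from \<open>n\<close> to \<open>n div p\<close>. The
  factor \<open>p - 1\<close> is the source of the exponent \<open>- 1 / (p - 1)\<close> in the
  radius of convergence.\<close>

lemma prime_multiplicity_fact_times_pred_le:
  assumes "prime p"
  shows "(p - 1) * multiplicity p (fact n :: nat) \<le> n"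
proof (induction n rule: less_induct)
  case (less n)
  have p: "1 < p"
    using assms by (rule prime_gt_1_nat)
  have "(p - 1) * multiplicity p (fact n :: nat) = (p - 1) * (n div p) + (p - 1) * multiplicity p (fact (n div p) :: nat)"
    using prime_multiplicity_fact_add[OF assms, of "n mod p" "n div p"] p
    by (simp add: prime_multiplicity_fact_mult[OF assms] distrib_left)
  also have "(p - 1) * multiplicity p (fact (n div p) :: nat) \<le> n div p"
    using less p by (cases "n = 0") auto
  also have "(p - 1) * (n div p) + n div p = p * (n div p)"
    using p by (simp add: algebra_simps)
  also have "\<dots> \<le> n"
    by simp
  finally show ?case by simp
qed

text \<open>Bernoulli's inequality compared with \<open>p ^ v \<le> n\<close>, where
  \<open>v\<close> is the multiplicity. This controls the denominators of the logarithm; the gain of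
  1 in \<open>n - 1\<close> is needed there.\<close>

lemma multiplicity_times_pred_le:
  assumes "1 < p" "0 < n"
  shows "(p - 1) * multiplicity p n \<le> n - 1"
proof -
  let ?v = "multiplicity p n"
  have "1 + real ?v * (real p - 1) \<le> (1 + (real p - 1)) ^ ?v"
    using assms by (intro Bernoulli_inequality) simp
  also have "\<dots> = real (p ^ ?v)"
    by simp
  also have "p ^ ?v \<le> n"
    using assms by (intro dvd_imp_le multiplicity_dvd)
  finally have "real (1 + ?v * (p - 1)) \<le> real n"
    using assms by (simp add: of_nat_diff)
  then show ?thesis
    by (simp only: of_nat_le_iff) (simp add: mult.commute)
qed

text \<open>\<open>fps_ln 1\<close> is the compositional inverse of \<open>fps_exp 1 - 1\<close>,
  which settles \<open>k = 1\<close>; composition commutes with powers, which gives the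
  rest.\<close>

lemma fps_exp_compose_ln:
  "fps_exp (of_nat k) oo fps_ln 1 = (1 + fps_X :: 'a::field_char_0 fps) ^ k"
proof -
  have "(fps_exp 1 - 1 :: 'a fps) oo fps_ln 1 = fps_X"
    using fps_inv_right[of "fps_exp 1 - 1 :: 'a fps"] by (simp add: fps_ln_fps_exp_inv)
  then have "fps_exp 1 oo fps_ln 1 = (1 + fps_X :: 'a fps)"
    by (simp add: fps_compose_sub_distrib algebra_simps)
  then show ?thesis
    using fps_compose_power[of "fps_ln 1 :: 'a fps" "fps_exp 1" k] by (simp add: fps_exp_power_mult)
qed

section \<open>The radius of convergence and the evaluation of exponential and logarithm\<close>

locale padic_complete_field =
  fixes p :: nat and T :: "'a::nonarch_field itself"
  assumes prime_p: "prime p"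
    and vabs_of_int: "z \<noteq> 0 \<Longrightarrow> vabs (of_int z :: 'a) = 1 / real p ^ multiplicity (int p) z"
    and complete_UNIV: "complete (UNIV :: 'a set)"
begin

text \<open>The radius of convergence of the p-adic exponential. As
  \<open>radius ^ (p - 1) = 1 / p\<close>, absolute values of nonzero integers are powers of
  it.\<close>

definition radius :: real where
  "radius = real p powr (- 1 / (real p - 1))"

lemma p_gt_1: "1 < p"
  using prime_p by (rule prime_gt_1_nat)

lemma radius_pos: "0 < radius"
  using p_gt_1 by (simp add: radius_def)

lemma radius_less_1: "radius < 1"
  using p_gt_1 unfolding radius_def by (intro powr_less_one) auto

lemma radius_power: "radius ^ ((p - 1) * k) = 1 / real p ^ k"
proof -
  have "radius ^ (p - 1) = real p powr (- 1 / (real p - 1) * real (p - 1))"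
    using p_gt_1 by (simp add: radius_def powr_powr flip: powr_realpow)
  also have "- 1 / (real p - 1) * real (p - 1) = - 1"
    using p_gt_1 by (simp add: of_nat_diff)
  finally show ?thesis
    using p_gt_1 by (simp add: power_mult powr_minus_divide power_one_over)
qed

lemma vabs_of_nat: "0 < n \<Longrightarrow> vabs (of_nat n :: 'a) = radius ^ ((p - 1) * multiplicity p n)"
  using vabs_of_int[of "int n"] radius_power by (simp add: multiplicity_int_int)

lemma vabs_of_nat_le_1: "vabs (of_nat n :: 'a) \<le> 1"
  using radius_pos radius_less_1 by (cases "n = 0") (simp_all add: vabs_of_nat power_le_one)

lemma vabs_of_nat_ge: "0 < n \<Longrightarrow> radius ^ (n - 1) \<le> vabs (of_nat n :: 'a)"
  using radius_pos radius_less_1 multiplicity_times_pred_le[OF p_gt_1]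
  by (simp add: vabs_of_nat power_decreasing)

lemma vabs_fact_ge: "radius ^ n \<le> vabs (fact n :: 'a)"
proof -
  have "vabs (fact n :: 'a) = radius ^ ((p - 1) * multiplicity p (fact n :: nat))"
    using vabs_of_nat[of "fact n"] by simp
  then show ?thesis
    using radius_pos radius_less_1 prime_multiplicity_fact_times_pred_le[OF prime_p]
    by (simp add: power_decreasing)
qed

text \<open>The room between \<open>vabs t\<close> and the radius of convergence is traded for geometric decay in \<open>n\<close>.\<close>

lemma vabs_fps_ln_power_le:
  fixes t :: 'a
  assumes s: "vabs t < s" "s \<le> radius"
  shows "vabs (fps_nth (fps_ln 1 ^ j) n * t ^ n) \<le> s ^ j * (vabs t / s) ^ n"
proof (induction j arbitrary: n)
  case 0
  have "0 < s"
    using s(1) vabs_nonneg[of t] by linarith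
  then show ?case by (cases "n = 0") simp_all
next
  case (Suc j)
  have "0 < s"
    using s(1) vabs_nonneg[of t] by linarith
  \<comment> \<open>The exponent \<open>i - 1\<close> in \<open>vabs_of_nat_ge\<close> leaves one
    factor \<open>s\<close> over. Across \<open>j\<close> factors these build up
    \<open>s ^ j\<close>, which later compensates the denominator \<open>fact j\<close>.\<close>
  have base: "vabs (fps_nth (fps_ln 1) i * t ^ i) \<le> s * (vabs t / s) ^ i" for i
  proof (cases "i = 0")
    case False
    have "s ^ (i - 1) \<le> radius ^ (i - 1)"
      using s(2) \<open>0 < s\<close> by (intro power_mono) auto
    also have "\<dots> \<le> vabs (of_nat i :: 'a)"
      using vabs_of_nat_ge False by simp
    finally have le: "s ^ (i - 1) \<le> vabs (of_nat i :: 'a)" .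
    moreover have "0 < s ^ (i - 1)"
      using \<open>0 < s\<close> by simp
    ultimately have "0 < vabs (of_nat i :: 'a)"
      by linarith
    with le \<open>0 < s\<close> have "vabs t ^ i / vabs (of_nat i :: 'a) \<le> vabs t ^ i / s ^ (i - 1)"
      by (intro divide_left_mono mult_pos_pos) simp_all
    also have "\<dots> = s * (vabs t / s) ^ i"
      using \<open>0 < s\<close> False by (cases i) (simp_all add: power_divide)
    finally show ?thesis
      using False by (simp add: fps_ln_nth vabs_mult vabs_divide vabs_power)
  qed (use \<open>0 < s\<close> in simp)
  have "vabs (\<Sum>i=0..n. fps_nth (fps_ln 1) i * fps_nth (fps_ln 1 ^ j) (n - i) * t ^ n)
      \<le> s ^ Suc j * (vabs t / s) ^ n"
  proof (rule vabs_sum_le)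
    fix i assume "i \<in> {0..n}"
    then have i: "i + (n - i) = n" by simp
    have "vabs ((fps_nth (fps_ln 1) i * t ^ i) * (fps_nth (fps_ln 1 ^ j) (n - i) * t ^ (n - i)))
        \<le> (s * (vabs t / s) ^ i) * (s ^ j * (vabs t / s) ^ (n - i))"
      unfolding vabs_mult[of "_ * t ^ i"] using base Suc \<open>0 < s\<close> by (intro mult_mono) auto
    also have "\<dots> = s ^ Suc j * (vabs t / s) ^ (i + (n - i))"
      by (simp add: power_add)
    also have "(fps_nth (fps_ln 1) i * t ^ i) * (fps_nth (fps_ln 1 ^ j) (n - i) * t ^ (n - i))
        = fps_nth (fps_ln 1) i * fps_nth (fps_ln 1 ^ j) (n - i) * t ^ (i + (n - i))"
      by (simp add: power_add)
    finally show "vabs (fps_nth (fps_ln 1) i * fps_nth (fps_ln 1 ^ j) (n - i) * t ^ n)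
        \<le> s ^ Suc j * (vabs t / s) ^ n"
      by (simp only: i)
  qed (use \<open>0 < s\<close> in simp)
  then show ?case
    by (simp add: fps_mult_nth sum_distrib_right)
qed

text \<open>Evaluation at \<open>t\<close> turns powers of the formal logarithm into powers of
  \<open>padic_log\<close>: induction on \<open>j\<close> by Cauchy products, possible because the
  decay ratio \<open>x\<close> is the same for all \<open>j\<close>.\<close>

lemma padic_log_power:
  fixes t :: 'a
  assumes "vabs t < radius"
  shows "(\<lambda>n. fps_nth (fps_ln 1 ^ j) n * t ^ n) sums (padic_log (1 + t) ^ j)"
proof -
  obtain s where s: "vabs t < s" "s < radius"
    using dense[OF assms] by blast
  have "0 < s"
    using s(1) vabs_nonneg[of t] by linarith
  define x where "x = vabs t / s"
  have x: "0 \<le> x" "x < 1"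
    using s(1) \<open>0 < s\<close> by (simp_all add: x_def)
  let ?h = "\<lambda>j n. fps_nth (fps_ln 1 ^ j) n * t ^ n"
  have bound: "vabs (?h j n) \<le> s ^ j * x ^ n" for j n
    unfolding x_def using s by (intro vabs_fps_ln_power_le) auto
  have summable: "summable (?h j)" for j
    using null_seq_geometric[OF bound x] by (rule nonarch_summable[OF complete_UNIV])
  \<comment> \<open>The formal logarithm has constant coefficient 0, while \<open>padic_log\<close>
    starts at the linear term; hence the shift by one.\<close>
  have log: "suminf (?h 1) = padic_log (1 + t)"
  proof -
    have "(\<lambda>N. \<Sum>n<Suc N. ?h 1 n) \<longlonglongrightarrow> suminf (?h 1)"
      using summable_LIMSEQ[OF summable] by (subst filterlim_sequentially_Suc)
    moreover have "(\<Sum>n<Suc N. ?h 1 n) = (\<Sum>n<N. (- 1) ^ n * t ^ Suc n / of_nat (Suc n))" for N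
      unfolding sum.lessThan_Suc_shift by (simp add: fps_ln_nth)
    ultimately have "(\<lambda>n. (- 1) ^ n * t ^ Suc n / of_nat (Suc n)) sums suminf (?h 1)"
      unfolding sums_def by simp
    then show ?thesis
      by (simp add: padic_log_def sums_iff)
  qed
  have "suminf (?h j) = padic_log (1 + t) ^ j"
  proof (induction j)
    case 0
    have "suminf (?h 0) = (\<Sum>n\<in>{0}. ?h 0 n)"
      by (rule suminf_finite) auto
    then show ?case by simp
  next
    case (Suc j)
    have "(\<Sum>i=0..n. ?h 1 i * ?h j (n - i)) = ?h (Suc j) n" for n
    proof -
      have "?h 1 i * ?h j (n - i) = fps_nth (fps_ln 1) i * fps_nth (fps_ln 1 ^ j) (n - i) * t ^ n"
        if "i \<in> {0..n}" for i
      proof -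
        have "t ^ n = t ^ i * t ^ (n - i)"
          using that by (simp flip: power_add)
        then show ?thesis by simp
      qed
      then have "(\<Sum>i=0..n. ?h 1 i * ?h j (n - i)) =
          (\<Sum>i=0..n. fps_nth (fps_ln 1) i * fps_nth (fps_ln 1 ^ j) (n - i) * t ^ n)"
        by (rule sum.cong[OF refl])
      then show ?thesis
        by (simp add: fps_mult_nth sum_distrib_right)
    qed
    then show ?case
      using nonarch_Cauchy_product[OF complete_UNIV bound[of 1] bound[of j] x] Suc log by simp
  qed
  with summable show ?thesis
    by (metis summable_sums)
qed

lemma qpow_of_nat:
  fixes q :: 'a
  assumes "vabs (q - 1) < radius"
  shows "qpow q (of_nat k) = q ^ k"
proof -
  define t where "t = q - 1"
  define L where "L = padic_log q"
  \<comment> \<open>Row \<open>j\<close> expands the \<open>j\<close>-th term of the exponential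
    series in powers of \<open>t\<close>; column \<open>n\<close> collects the coefficient of
    \<open>t ^ n\<close>.\<close>
  define c where "c j n = of_nat k ^ j / fact j * (fps_nth (fps_ln 1 ^ j) n * t ^ n)" for j n
  obtain s where s: "vabs t < s" "s < radius"
    using dense[OF assms] unfolding t_def by blast
  have "0 < s"
    using s(1) vabs_nonneg[of t] by linarith
  \<comment> \<open>The ratio \<open>vabs t / s\<close> gives decay in \<open>n\<close>, and
    \<open>s / radius\<close> gives decay in \<open>j\<close> against \<open>vabs (fact j)\<close>,
    which is at least \<open>radius ^ j\<close>.\<close>
  define x where "x = max (vabs t / s) (s / radius)"
  have x: "0 \<le> x" "x < 1"
    using s \<open>0 < s\<close> radius_pos by (simp_all add: x_def le_max_iff_disj)
  have bound: "vabs (c j n) \<le> x ^ (j + n)" for j n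
  proof -
    have "vabs (of_nat k ^ j :: 'a) \<le> 1"
      by (simp add: vabs_power vabs_of_nat_le_1 power_le_one)
    then have "vabs (of_nat k ^ j / fact j :: 'a) \<le> 1 / radius ^ j"
      unfolding vabs_divide using radius_pos vabs_fact_ge[of j] by (intro frac_le) auto
    then have "vabs (c j n) \<le> 1 / radius ^ j * (s ^ j * (vabs t / s) ^ n)"
      unfolding c_def vabs_mult[of "_ / _"]
      using vabs_fps_ln_power_le[of t s j n] s radius_pos by (intro mult_mono) auto
    also have "\<dots> = (s / radius) ^ j * (vabs t / s) ^ n"
      by (simp add: power_divide)
    also have "\<dots> \<le> x ^ j * x ^ n"
      using \<open>0 < s\<close> radius_pos x by (intro mult_mono power_mono) (auto simp: x_def)
    finally show ?thesis by (simp add: power_add)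
  qed
  have null: "null_family c"
    unfolding null_family_def
  proof (intro allI impI)
    fix e :: real assume "0 < e"
    then obtain N where N: "x ^ N < e"
      using real_arch_pow_inv[of e x] x by auto
    have "vabs (c j n) \<le> e" if "N \<le> j \<or> N \<le> n" for j n
    proof -
      have "x ^ (j + n) \<le> x ^ N"
        using x that by (intro power_decreasing) auto
      then show ?thesis
        using bound[of j n] N by linarith
    qed
    then show "\<exists>N. \<forall>i j. N \<le> i \<or> N \<le> j \<longrightarrow> vabs (c i j) \<le> e" by blast
  qed
  have "suminf (c j) = (of_nat k * L) ^ j / fact j" for j
    using nonarch_sums_mult[OF padic_log_power[of t j], of "of_nat k ^ j / fact j"] assms
    by (simp add: c_def[abs_def] t_def L_def sums_iff power_mult_distrib)
  then have "qpow q (of_nat k) = (\<Sum>j. \<Sum>n. c j n)"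
    by (simp add: qpow_def padic_exp_def L_def)
  also have "\<dots> = (\<Sum>n. \<Sum>j. c j n)"
    by (rule null_family_suminf_swap[OF complete_UNIV null])
  also have "(\<lambda>n. \<Sum>j. c j n) = (\<lambda>n. of_nat (k choose n) * t ^ n)"
  proof
    fix n
    \<comment> \<open>Since \<open>fps_ln 1\<close> has no constant term, its \<open>j\<close>-th
      power starts in degree \<open>j\<close>, so only \<open>j \<le> n\<close> contribute.\<close>
    have "(\<Sum>j. c j n) = (\<Sum>j\<in>{0..n}. c j n)"
      by (rule suminf_finite) (auto simp: c_def startsby_zero_power_prefix)
    also have "\<dots> = fps_nth (fps_exp (of_nat k) oo fps_ln 1) n * t ^ n"
      by (simp add: c_def fps_compose_nth sum_distrib_right mult.assoc)
    also have "\<dots> = of_nat (k choose n) * t ^ n"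
      unfolding fps_exp_compose_ln
      by (simp add: binomial_gbinomial flip: fps_binomial_of_nat)
    finally show "(\<Sum>j. c j n) = of_nat (k choose n) * t ^ n" .
  qed
  also have "(\<Sum>n. of_nat (k choose n) * t ^ n) = (\<Sum>n\<le>k. of_nat (k choose n) * t ^ n)"
    by (rule suminf_finite) auto
  also have "\<dots> = q ^ k"
    using binomial_ring[of t 1 k] by (simp add: t_def)
  finally show ?thesis .
qed

end

section \<open>Iterated fermionic integrals\<close>

lemma vabs_power_diff_le:
  fixes x y :: "'a::nonarch_field"
  assumes "vabs x \<le> 1" "vabs y \<le> 1"
  shows "vabs (x ^ n - y ^ n) \<le> vabs (x - y)"
proof (induction n)
  case (Suc n)
  show ?case
    unfolding power_Suc using assms Suc
    by (intro vabs_diff_mult_le[where B = 1 and C = 1]) (simp_all add: vabs_power power_le_one)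
qed simp

lemma sum_lessThan_mult:
  fixes h :: "nat \<Rightarrow> 'b::comm_monoid_add"
  shows "(\<Sum>y<f * k. h y) = (\<Sum>m<f. \<Sum>z<k. h (m + f * z))"
proof -
  have "(\<Sum>y<f * k. h y) = (\<Sum>z<k. \<Sum>y=z * f..<z * f + f. h y)"
    by (simp add: sum.nat_group mult.commute)
  also have "\<dots> = (\<Sum>z<k. \<Sum>m<f. h (m + f * z))"
  proof (rule sum.cong[OF refl])
    show "(\<Sum>y=z * f..<z * f + f. h y) = (\<Sum>m<f. h (m + f * z))" for z
      using sum.shift_bounds_nat_ivl[of h 0 "z * f" f]
      by (simp add: lessThan_atLeast0 add.commute mult.commute)
  qed
  finally show ?thesis
    by (simp add: sum.swap[of _ "{..<k}"])
qed

lemma sum_neg_one_power_odd: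
  assumes "odd k"
  shows "(\<Sum>i<k. (- 1) ^ i) = (1 :: 'b::comm_ring_1)"
proof -
  have "(\<Sum>i<k. (- 1) ^ i) = (if odd k then 1 else 0 :: 'b)"
    by (induction k) auto
  with assms show ?thesis by simp
qed

lemma neg_one_power_add_odd_mult:
  "odd f \<Longrightarrow> (- 1) ^ (m + f * z) = ((- 1) ^ m * (- 1) ^ z :: 'b::comm_ring_1)"
  by (simp add: power_add power_mult)

text \<open>The coordinate \<open>Suc r\<close> is split off outermost, as in the recursion of
  \<open>iterated_integral\<close>.\<close>

lemma sum_PiE_Suc:
  "(\<Sum>m\<in>{1..Suc r} \<rightarrow>\<^sub>E S. F m) = (\<Sum>k\<in>S. \<Sum>m\<in>{1..r} \<rightarrow>\<^sub>E S. F (m(Suc r := k)))"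
proof -
  have "{1..Suc r} = insert (Suc r) {1..r}"
    by auto
  then have "{1..Suc r} \<rightarrow>\<^sub>E S = (\<lambda>(k, m). m(Suc r := k)) ` (S \<times> ({1..r} \<rightarrow>\<^sub>E S))"
    by (simp add: PiE_insert_eq)
  moreover have "inj_on (\<lambda>(k, m). m(Suc r := k)) (S \<times> ({1..r} \<rightarrow>\<^sub>E S))"
    by (rule inj_combinator) simp
  ultimately show ?thesis
    by (simp add: sum.reindex sum.cartesian_product case_prod_unfold)
qed

text \<open>An integral that samples its integrand only at points \<open>\<phi> y\<close> can be
  rewritten over the parameters \<open>y\<close>. Only the coordinates \<open>1..r\<close> are
  related, because the others are \<open>undefined\<close> on both sides.\<close>

lemma iterated_integral_transfer:
  assumes "\<And>g. I g = I' (\<lambda>y. g (\<phi> y))"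
    and "\<And>x y. (\<And>j. j \<in> {1..r} \<Longrightarrow> x j = \<phi> (y j)) \<Longrightarrow> G x = H y"
  shows "iterated_integral I r G = iterated_integral I' r H"
  using assms(2)
proof (induction r arbitrary: G H)
  case (Suc r)
  have "iterated_integral I r (\<lambda>x. G (x(Suc r := \<phi> y))) =
      iterated_integral I' r (\<lambda>x. H (x(Suc r := y)))" for y
    by (rule Suc.IH, rule Suc.prems) auto
  then show ?case
    unfolding iterated_integral.simps assms(1)[of "\<lambda>y. iterated_integral I r (\<lambda>x. G (x(Suc r := y)))"]
    by simp
qed simp

text \<open>With \<open>f = 1\<close> this is the integral over the $p$-adic integers, and otherwise the one over \<open>X\<close>.\<close>

definition alternating_limit :: "nat \<Rightarrow> nat \<Rightarrow> (nat \<Rightarrow> 'a::nonarch_field) \<Rightarrow> 'a" where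
  "alternating_limit p f g = lim (\<lambda>N. \<Sum>y<f * p ^ N. g y * (- 1) ^ y)"

lemma alternating_limit_eqI:
  assumes "(\<lambda>N. \<Sum>y<f * p ^ N. g y * (- 1) ^ y) \<longlonglongrightarrow> (l :: 'a::nonarch_field)"
  shows "alternating_limit p f g = l"
  using assms by (simp add: alternating_limit_def limI)

text \<open>Uniform continuity for the p-adic metric on the natural numbers, with congruence modulo
  \<open>p ^ N\<close> in place of a distance.\<close>

definition padic_uniform1 :: "nat \<Rightarrow> (nat \<Rightarrow> 'a::nonarch_field) \<Rightarrow> bool" where
  "padic_uniform1 p g \<longleftrightarrow>
     (\<forall>e>0. \<exists>N. \<forall>x y. [x = y] (mod p ^ N) \<longrightarrow> vabs (g x - g y) \<le> e)"

text \<open>This forces \<open>H\<close> to depend on the coordinates \<open>1, \<dots>, r\<close> only.\<close>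

definition padic_uniform :: "nat \<Rightarrow> nat \<Rightarrow> ((nat \<Rightarrow> nat) \<Rightarrow> 'a::nonarch_field) \<Rightarrow> bool" where
  "padic_uniform p r H \<longleftrightarrow>
     (\<forall>e>0. \<exists>N. \<forall>x y. (\<forall>j\<in>{1..r}. [x j = y j] (mod p ^ N)) \<longrightarrow> vabs (H x - H y) \<le> e)"

lemma padic_uniform1_sum:
  fixes g :: "'i \<Rightarrow> nat \<Rightarrow> 'a::nonarch_field"
  assumes "finite A" "\<And>i. i \<in> A \<Longrightarrow> padic_uniform1 p (g i)"
  shows "padic_uniform1 p (\<lambda>y. \<Sum>i\<in>A. (- 1) ^ c i * g i y)"
  unfolding padic_uniform1_def
proof (intro allI impI)
  fix e :: real assume "0 < e"
  then have "\<forall>i\<in>A. \<exists>N. \<forall>x y. [x = y] (mod p ^ N) \<longrightarrow> vabs (g i x - g i y) \<le> e"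
    using assms(2) unfolding padic_uniform1_def by blast
  then obtain N where N: "\<And>i x y. i \<in> A \<Longrightarrow> [x = y] (mod p ^ N i) \<Longrightarrow> vabs (g i x - g i y) \<le> e"
    by metis
  \<comment> \<open>The sum of the exponents \<open>N i\<close> is a common exponent, being at least
    each of them.\<close>
  have "vabs ((\<Sum>i\<in>A. (- 1) ^ c i * g i x) - (\<Sum>i\<in>A. (- 1) ^ c i * g i y)) \<le> e"
    if "[x = y] (mod p ^ (\<Sum>i\<in>A. N i))" for x y
    unfolding sum_subtractf[symmetric] right_diff_distrib[symmetric]
  proof (rule vabs_sum_le)
    fix i assume "i \<in> A"
    then have "p ^ N i dvd p ^ (\<Sum>i\<in>A. N i)"
      using assms(1) by (intro le_imp_power_dvd member_le_sum) auto
    then show "vabs ((- 1) ^ c i * (g i x - g i y)) \<le> e"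
      using N[OF \<open>i \<in> A\<close>] that by (simp add: vabs_mult cong_dvd_modulus_nat)
  qed (use \<open>0 < e\<close> in simp)
  then show "\<exists>N. \<forall>x y. [x = y] (mod p ^ N) \<longrightarrow>
      vabs ((\<Sum>i\<in>A. (- 1) ^ c i * g i x) - (\<Sum>i\<in>A. (- 1) ^ c i * g i y)) \<le> e"
    by blast
qed

lemma padic_uniform_slice:
  assumes "padic_uniform p (Suc r) H"
  shows "padic_uniform p r (\<lambda>x. H (x(Suc r := y)))"
  unfolding padic_uniform_def
proof (intro allI impI)
  fix e :: real assume "0 < e"
  then obtain N where N: "\<And>x y. (\<forall>j\<in>{1..Suc r}. [x j = y j] (mod p ^ N)) \<Longrightarrow> vabs (H x - H y) \<le> e"
    using assms unfolding padic_uniform_def by metis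
  show "\<exists>N. \<forall>x x'. (\<forall>j\<in>{1..r}. [x j = x' j] (mod p ^ N)) \<longrightarrow>
      vabs (H (x(Suc r := y)) - H (x'(Suc r := y))) \<le> e"
    by (intro exI[of _ N] allI impI N) auto
qed

lemma padic_uniform_cmult:
  assumes "padic_uniform p r H"
  shows "padic_uniform p r (\<lambda>x. c * H x)"
  unfolding padic_uniform_def
proof (intro allI impI)
  fix e :: real assume "0 < e"
  \<comment> \<open>The \<open>+ 1\<close> avoids a division by zero when
    \<open>c = 0\<close>.\<close>
  then have "0 < e / (vabs c + 1)"
    by (simp add: add_nonneg_pos)
  then obtain N where N: "\<And>x y. (\<forall>j\<in>{1..r}. [x j = y j] (mod p ^ N)) \<Longrightarrow> vabs (H x - H y) \<le> e / (vabs c + 1)"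
    using assms unfolding padic_uniform_def by metis
  have "vabs (c * H x - c * H y) \<le> e" if "\<forall>j\<in>{1..r}. [x j = y j] (mod p ^ N)" for x y
  proof -
    have "vabs c * vabs (H x - H y) \<le> (vabs c + 1) * (e / (vabs c + 1))"
      using N[OF that] by (intro mult_mono) auto
    also have "\<dots> = e"
      using add_nonneg_pos[OF vabs_nonneg[of c] zero_less_one] by simp
    finally show ?thesis
      by (simp add: vabs_mult flip: right_diff_distrib)
  qed
  then show "\<exists>N. \<forall>x y. (\<forall>j\<in>{1..r}. [x j = y j] (mod p ^ N)) \<longrightarrow> vabs (c * H x - c * H y) \<le> e"
    by blast
qed

text \<open>Without coordinates the congruence condition is vacuous, so the difference is below
  every positive bound. This handles the \<open>undefined\<close> point at which
  \<open>iterated_integral\<close> stops.\<close>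

lemma padic_uniform_0_eq:
  assumes "padic_uniform p 0 H"
  shows "H x = H y"
proof (rule ccontr)
  assume "H x \<noteq> H y"
  then have "0 < vabs (H x - H y)"
    by (simp add: less_le)
  then have "0 < vabs (H x - H y) / 2"
    by simp
  then have "vabs (H x - H y) \<le> vabs (H x - H y) / 2"
    using assms unfolding padic_uniform_def by (metis atLeastatMost_empty_iff2 empty_iff less_numeral_extra(1) not_one_le_zero)
  with \<open>0 < vabs (H x - H y)\<close> show False by simp
qed

section \<open>Existence, continuity and linearity of the iterated limits\<close>

context padic_complete_field
begin

context
  assumes odd_p: "odd p"
begin

text \<open>Passing from level \<open>N\<close> to \<open>Suc N\<close> replaces each residue
  \<open>m\<close> by its lifts \<open>m + p ^ N * i\<close>, where \<open>g\<close> has almost the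
  same value. Consecutive partial sums therefore become close, which suffices in a complete
  ultrametric field.\<close>

lemma alternating_limit_LIMSEQ:
  fixes g :: "nat \<Rightarrow> 'a"
  assumes "padic_uniform1 p g"
  shows "(\<lambda>N. \<Sum>y<p ^ N. g y * (- 1) ^ y) \<longlonglongrightarrow> alternating_limit p 1 g"
proof -
  let ?S = "\<lambda>N. \<Sum>y<p ^ N. g y * (- 1) ^ y"
  \<comment> \<open>Each \<open>m\<close> contributes \<open>p\<close> terms with alternating signs, and these signs add up to 1 as \<open>p\<close> is odd.\<close>
  have diff: "?S (Suc N) - ?S N =
      (\<Sum>m<p ^ N. \<Sum>i<p. (g (m + p ^ N * i) - g m) * (- 1) ^ (m + i))" for N
  proof -
    have "?S (Suc N) = (\<Sum>m<p ^ N. \<Sum>i<p. g (m + p ^ N * i) * (- 1) ^ (m + i))"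
      using odd_p sum_lessThan_mult[of "\<lambda>y. g y * (- 1) ^ y" "p ^ N" p]
      by (simp add: mult.commute[of p "p ^ N"] power_add power_mult)
    moreover have "?S N = (\<Sum>m<p ^ N. \<Sum>i<p. g m * (- 1) ^ (m + i))"
      by (simp add: power_add sum_neg_one_power_odd[OF odd_p] flip: sum_distrib_left mult.assoc)
    ultimately show ?thesis
      by (simp add: sum_subtractf left_diff_distrib)
  qed
  have "(\<lambda>N. ?S (Suc N) - ?S N) \<longlonglongrightarrow> 0"
    unfolding lim_sequentially
  proof (intro allI impI)
    fix e :: real assume "0 < e"
    then have "0 < e / 2" by simp
    then obtain M where M: "\<And>x y. [x = y] (mod p ^ M) \<Longrightarrow> vabs (g x - g y) \<le> e / 2"
      using assms unfolding padic_uniform1_def by metis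
    have "vabs (?S (Suc N) - ?S N) \<le> e / 2" if "M \<le> N" for N
      unfolding diff
    proof (intro vabs_sum_le)
      fix m i
      have "p ^ M dvd p ^ N * i"
        using that by (simp add: le_imp_power_dvd)
      then have "[m + p ^ N * i = m] (mod p ^ M)"
        by (simp add: cong_def mod_add_right_eq[symmetric, of m "p ^ N * i"] mod_eq_0_iff_dvd[THEN iffD2])
      from M[OF this] show "vabs ((g (m + p ^ N * i) - g m) * (- 1) ^ (m + i)) \<le> e / 2"
        by (simp add: vabs_mult)
    qed (use \<open>0 < e\<close> in simp_all)
    then have "dist (?S (Suc N) - ?S N) 0 < e" if "M \<le> N" for N
      using order_le_less_trans[of "vabs (?S (Suc N) - ?S N)" "e / 2" e] that \<open>0 < e\<close>
      by (simp add: dist_vabs del: power_Suc)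
    then show "\<exists>M. \<forall>N\<ge>M. dist (?S (Suc N) - ?S N) 0 < e"
      by blast
  qed
  then have "convergent ?S"
    by (rule convergent_if_diff_null[OF complete_UNIV])
  then show ?thesis
    by (simp add: alternating_limit_def convergent_LIMSEQ_iff)
qed

text \<open>The signs have absolute value 1, so neither the partial sums nor their limit can enlarge
  a uniform bound on the difference.\<close>

lemma vabs_alternating_limit_diff_le:
  fixes g h :: "nat \<Rightarrow> 'a"
  assumes "padic_uniform1 p g" "padic_uniform1 p h" "0 \<le> e" "\<And>y. vabs (g y - h y) \<le> e"
  shows "vabs (alternating_limit p 1 g - alternating_limit p 1 h) \<le> e"
proof (rule vabs_lim_le)
  show "(\<lambda>N. (\<Sum>y<p ^ N. g y * (- 1) ^ y) - (\<Sum>y<p ^ N. h y * (- 1) ^ y)) \<longlonglongrightarrow>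
      alternating_limit p 1 g - alternating_limit p 1 h"
    using assms(1,2) by (intro tendsto_intros alternating_limit_LIMSEQ)
  show "vabs ((\<Sum>y<p ^ N. g y * (- 1) ^ y) - (\<Sum>y<p ^ N. h y * (- 1) ^ y)) \<le> e" for N
    unfolding sum_subtractf[symmetric] left_diff_distrib[symmetric]
    using assms(3,4) by (intro vabs_sum_le) (simp_all add: vabs_mult)
qed

lemma alternating_limit_sum:
  fixes g :: "'i \<Rightarrow> nat \<Rightarrow> 'a"
  assumes "\<And>i. i \<in> A \<Longrightarrow> padic_uniform1 p (g i)"
  shows "alternating_limit p 1 (\<lambda>y. \<Sum>i\<in>A. c i * g i y) = (\<Sum>i\<in>A. c i * alternating_limit p 1 (g i))"
proof (rule alternating_limit_eqI)
  have "(\<lambda>N. \<Sum>i\<in>A. c i * (\<Sum>y<p ^ N. g i y * (- 1) ^ y)) \<longlonglongrightarrow>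
      (\<Sum>i\<in>A. c i * alternating_limit p 1 (g i))"
    using assms by (intro tendsto_intros alternating_limit_LIMSEQ)
  moreover have "(\<Sum>i\<in>A. c i * (\<Sum>y<p ^ N. g i y * (- 1) ^ y)) =
      (\<Sum>y<1 * p ^ N. (\<Sum>i\<in>A. c i * g i y) * (- 1) ^ y)" for N
    by (simp add: sum_distrib_left sum_distrib_right mult.assoc sum.swap[of _ A])
  ultimately show "(\<lambda>N. \<Sum>y<1 * p ^ N. (\<Sum>i\<in>A. c i * g i y) * (- 1) ^ y) \<longlonglongrightarrow>
      (\<Sum>i\<in>A. c i * alternating_limit p 1 (g i))"
    by simp
qed

lemma alternating_limit_cmult:
  fixes g :: "nat \<Rightarrow> 'a"
  assumes "padic_uniform1 p g"
  shows "alternating_limit p 1 (\<lambda>y. c * g y) = c * alternating_limit p 1 g"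
  using alternating_limit_sum[of "{()}" "\<lambda>_. g" "\<lambda>_. c"] assms by simp

text \<open>The decomposition by residues modulo \<open>f\<close> is exact at every finite level,
  and each of the finitely many classes has its own limit. No continuity across different classes is
  assumed.\<close>

lemma alternating_limit_split:
  fixes g :: "nat \<Rightarrow> 'a"
  assumes "odd f" "\<And>k. k < f \<Longrightarrow> padic_uniform1 p (\<lambda>w. g (k + f * w))"
  shows "alternating_limit p f g = (\<Sum>k<f. (- 1) ^ k * alternating_limit p 1 (\<lambda>w. g (k + f * w)))"
proof (rule alternating_limit_eqI)
  have "(\<lambda>N. \<Sum>k<f. (- 1) ^ k * (\<Sum>w<p ^ N. g (k + f * w) * (- 1) ^ w)) \<longlonglongrightarrow>
      (\<Sum>k<f. (- 1) ^ k * alternating_limit p 1 (\<lambda>w. g (k + f * w)))"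
    using assms(2) by (intro tendsto_intros alternating_limit_LIMSEQ) simp
  moreover have "(\<Sum>k<f. (- 1) ^ k * (\<Sum>w<p ^ N. g (k + f * w) * (- 1) ^ w)) =
      (\<Sum>y<f * p ^ N. g y * (- 1) ^ y)" for N
    unfolding sum_lessThan_mult neg_one_power_add_odd_mult[OF assms(1)]
    by (simp add: sum_distrib_left mult.left_commute)
  ultimately show "(\<lambda>N. \<Sum>y<f * p ^ N. g y * (- 1) ^ y) \<longlonglongrightarrow>
      (\<Sum>k<f. (- 1) ^ k * alternating_limit p 1 (\<lambda>w. g (k + f * w)))"
    by simp
qed

text \<open>Uniformity in the outer variable and the bound on differences of integrals depend on
  each other. Taking the bound in dimension \<open>r\<close> as the hypothesis \<open>le\<close>
  breaks the circle: it is first supplied by an induction hypothesis, then by the finished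
  lemma.\<close>

lemma padic_uniform1_iterated_step:
  fixes F :: "(nat \<Rightarrow> nat) \<Rightarrow> 'a"
  defines "I \<equiv> iterated_integral (alternating_limit p 1 :: (nat \<Rightarrow> 'a) \<Rightarrow> 'a)"
  assumes le: "\<And>G H e. \<lbrakk>padic_uniform p r G; padic_uniform p r H; 0 \<le> e; \<And>x. vabs (G x - H x) \<le> e\<rbrakk> \<Longrightarrow>
      vabs (I r G - I r H) \<le> e"
    and F: "padic_uniform p (Suc r) F"
  shows "padic_uniform1 p (\<lambda>y. I r (\<lambda>x. F (x(Suc r := y))))"
  unfolding padic_uniform1_def
proof (intro allI impI)
  fix e :: real assume "0 < e"
  then obtain N where N: "\<And>x y. (\<forall>j\<in>{1..Suc r}. [x j = y j] (mod p ^ N)) \<Longrightarrow> vabs (F x - F y) \<le> e"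
    using F unfolding padic_uniform_def by metis
  show "\<exists>N. \<forall>y y'. [y = y'] (mod p ^ N) \<longrightarrow>
      vabs (I r (\<lambda>x. F (x(Suc r := y))) - I r (\<lambda>x. F (x(Suc r := y')))) \<le> e"
    using \<open>0 < e\<close> by (intro exI[of _ N] allI impI le padic_uniform_slice F N) auto
qed

lemma vabs_iterated_diff_le:
  fixes G H :: "(nat \<Rightarrow> nat) \<Rightarrow> 'a"
  assumes "padic_uniform p r G" "padic_uniform p r H" "0 \<le> e" "\<And>x. vabs (G x - H x) \<le> e"
  shows "vabs (iterated_integral (alternating_limit p 1) r G -
    iterated_integral (alternating_limit p 1) r H) \<le> e"
  using assms
proof (induction r arbitrary: G H e)
  case (Suc r)
  show ?case
    unfolding iterated_integral.simps
    by (intro vabs_alternating_limit_diff_le padic_uniform1_iterated_step Suc.IH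
        padic_uniform_slice Suc.prems)
qed simp

lemma padic_uniform1_iterated:
  fixes F :: "(nat \<Rightarrow> nat) \<Rightarrow> 'a"
  assumes "padic_uniform p (Suc r) F"
  shows "padic_uniform1 p (\<lambda>y. iterated_integral (alternating_limit p 1) r (\<lambda>x. F (x(Suc r := y))))"
  using assms by (intro padic_uniform1_iterated_step vabs_iterated_diff_le)

lemma iterated_alternating_limit_cmult:
  fixes H :: "(nat \<Rightarrow> nat) \<Rightarrow> 'a"
  assumes "padic_uniform p r H"
  shows "iterated_integral (alternating_limit p 1) r (\<lambda>x. c * H x) =
    c * iterated_integral (alternating_limit p 1) r H"
  using assms
proof (induction r arbitrary: H)
  case (Suc r)
  then show ?case
    by (simp add: padic_uniform_slice alternating_limit_cmult[OF padic_uniform1_iterated] del: One_nat_def)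
qed simp

text \<open>Continuity is only required on each residue class modulo \<open>f\<close>, because a character modulo \<open>f\<close>
  is not $p$-adically continuous on the natural numbers.\<close>

lemma iterated_alternating_limit_split:
  fixes H :: "(nat \<Rightarrow> nat) \<Rightarrow> 'a"
  assumes "odd f" "\<And>m. padic_uniform p r (\<lambda>z. H (\<lambda>j. m j + f * z j))"
  shows "iterated_integral (alternating_limit p f) r H =
    (\<Sum>m\<in>{1..r} \<rightarrow>\<^sub>E {..<f}. (- 1) ^ (\<Sum>j=1..r. m j) *
       iterated_integral (alternating_limit p 1) r (\<lambda>z. H (\<lambda>j. m j + f * z j)))"
  using assms(2)
proof (induction r arbitrary: H)
  case 0
  then show ?case
    using padic_uniform_0_eq[OF 0[of "\<lambda>_. undefined"], of "\<lambda>_. undefined" "\<lambda>_. 0"]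
    by simp
next
  case (Suc r)
  let ?J = "alternating_limit p 1" and ?P = "{1..r} \<rightarrow>\<^sub>E {..<f}"
  have slice: "(\<lambda>j. (m(Suc r := k)) j + f * (z(Suc r := w)) j) = (\<lambda>j. m j + f * z j)(Suc r := k + f * w)"
    for m z :: "nat \<Rightarrow> nat" and k w
    by auto
  \<comment> \<open>Any value \<open>y\<close> of the last coordinate is reached by the shift
    \<open>y\<close> together with \<open>w = 0\<close>.\<close>
  have uniform_slice: "padic_uniform p r (\<lambda>z. H ((\<lambda>j. m j + f * z j)(Suc r := y)))" for m y
    using padic_uniform_slice[OF Suc.prems[of "m(Suc r := y)"], of 0] unfolding slice by simp
  have uniform: "padic_uniform1 p
      (\<lambda>w. iterated_integral ?J r (\<lambda>z. H ((\<lambda>j. m j + f * z j)(Suc r := k + f * w))))" for m k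
    using padic_uniform1_iterated[OF Suc.prems[of "m(Suc r := k)"]] unfolding slice .
  \<comment> \<open>The inner variables are split first, under the outer limit. The outer split then
    meets a finite sum of functions that are uniform on each class.\<close>
  have "iterated_integral (alternating_limit p f) (Suc r) H =
      alternating_limit p f (\<lambda>y. \<Sum>m\<in>?P. (- 1) ^ (\<Sum>j=1..r. m j) *
        iterated_integral ?J r (\<lambda>z. H ((\<lambda>j. m j + f * z j)(Suc r := y))))"
    unfolding iterated_integral.simps by (simp only: Suc.IH[OF uniform_slice])
  also have "\<dots> = (\<Sum>k<f. (- 1) ^ k * ?J (\<lambda>w. \<Sum>m\<in>?P. (- 1) ^ (\<Sum>j=1..r. m j) *
        iterated_integral ?J r (\<lambda>z. H ((\<lambda>j. m j + f * z j)(Suc r := k + f * w)))))"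
    by (rule alternating_limit_split[OF assms(1)]) (intro padic_uniform1_sum uniform finite_PiE, simp_all)
  also have "\<dots> = (\<Sum>k<f. \<Sum>m\<in>?P. (- 1) ^ (k + (\<Sum>j=1..r. m j)) *
      ?J (\<lambda>w. iterated_integral ?J r (\<lambda>z. H ((\<lambda>j. m j + f * z j)(Suc r := k + f * w)))))"
    by (simp only: alternating_limit_sum[OF uniform] sum_distrib_left power_add mult.assoc)
  also have "\<dots> = (\<Sum>k<f. \<Sum>m\<in>?P. (- 1) ^ (\<Sum>j=1..Suc r. (m(Suc r := k)) j) *
      iterated_integral ?J (Suc r) (\<lambda>z. H (\<lambda>j. (m(Suc r := k)) j + f * z j)))"
  proof (intro sum.cong refl)
    fix k and m :: "nat \<Rightarrow> nat"
    have "(\<Sum>j=1..Suc r. (m(Suc r := k)) j) = k + (\<Sum>j=1..r. m j)"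
      by (simp add: add.commute)
    then show "(- 1) ^ (k + (\<Sum>j=1..r. m j)) *
        ?J (\<lambda>w. iterated_integral ?J r (\<lambda>z. H ((\<lambda>j. m j + f * z j)(Suc r := k + f * w)))) =
      (- 1) ^ (\<Sum>j=1..Suc r. (m(Suc r := k)) j) *
        iterated_integral ?J (Suc r) (\<lambda>z. H (\<lambda>j. (m(Suc r := k)) j + f * z j))"
      by (simp only: iterated_integral.simps slice)
  qed
  also have "\<dots> = (\<Sum>m\<in>{1..Suc r} \<rightarrow>\<^sub>E {..<f}. (- 1) ^ (\<Sum>j=1..Suc r. m j) *
      iterated_integral ?J (Suc r) (\<lambda>z. H (\<lambda>j. m j + f * z j)))"
    by (simp only: sum_PiE_Suc)
  finally show ?case .
qed

end

end

section \<open>The distribution relation\<close>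

text \<open>As soon as \<open>y \<le> N\<close>, the number \<open>y\<close> is its own least
  residue modulo \<open>f * p ^ N\<close>, so the coherent sequence is eventually constant.\<close>

lemma X_to_Zp_X_of_nat:
  assumes "1 < p" "0 < f"
  shows "X_to_Zp (X_of_nat p f y) = (of_nat y :: 'a::nonarch_field)"
proof -
  have "X_of_nat p f y N = y" if "y \<le> N" for N
  proof -
    have "y < p ^ N"
      using that less_exp[of N] power_mono[of 2 p N] assms(1) by linarith
    also have "\<dots> \<le> f * p ^ N"
      using assms(2) by simp
    finally show ?thesis
      by (simp add: X_of_nat_def)
  qed
  then have "(\<lambda>N. of_nat (X_of_nat p f y N)) \<longlonglongrightarrow> (of_nat y :: 'a)"
    by (intro tendsto_eventually) (auto simp: eventually_sequentially)
  then show ?thesis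
    by (simp add: X_to_Zp_def limI)
qed

lemma dirichlet_character_add_mult:
  assumes "dirichlet_character f chi"
  shows "chi (int (m + f * z)) = chi (int m)"
proof (induction z)
  case (Suc z)
  have "chi (int (m + f * z) + int f) = chi (int (m + f * z))"
    using assms by (simp only: dirichlet_character_def)
  with Suc show ?case
    by (simp add: algebra_simps)
qed simp

lemma dirichlet_character_mod:
  assumes "dirichlet_character f chi"
  shows "chi (int (y mod f)) = chi (int y)"
  using dirichlet_character_add_mult[OF assms, of "y mod f" "y div f"] by simp

section \<open>Uniform continuity of the integrand and passage to natural arguments\<close>

context padic_complete_field
begin

lemma vabs_of_p: "vabs (of_nat p :: 'a) = 1 / real p"
  using vabs_of_int[of "int p"] p_gt_1 by (simp add: multiplicity_int_int multiplicity_self)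

text \<open>With \<open>v = q ^ p ^ N\<close>, the number \<open>v ^ p - 1\<close> is
  \<open>v - 1\<close> times \<open>\<Sum>i<p. v ^ i\<close>. The latter differs from
  \<open>p\<close> by terms \<open>v ^ i - 1\<close> of size at most \<open>c\<close>, so every
  \<open>p\<close>-th power gains a factor \<open>c\<close>.\<close>

lemma vabs_power_p_power_le:
  fixes q :: 'a
  assumes "vabs (q - 1) \<le> c" "1 / real p \<le> c" "c \<le> 1"
  shows "vabs (q ^ p ^ N - 1) \<le> c ^ Suc N"
proof (induction N)
  case (Suc N)
  define v where "v = q ^ p ^ N"
  have "0 \<le> c"
    using assms(1) vabs_nonneg order_trans by blast
  have v1: "vabs (v - 1) \<le> c ^ Suc N"
    using Suc by (simp only: v_def)
  also have "\<dots> \<le> c"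
    using \<open>0 \<le> c\<close> assms(3) by (simp add: mult_left_le power_le_one)
  finally have vc: "vabs (v - 1) \<le> c" .
  then have v: "vabs v \<le> 1"
    using assms(3) vabs_le_1_near_1[of v] by simp
  have "vabs (of_nat p :: 'a) \<le> c"
    using vabs_of_p assms(2) by simp
  moreover have "vabs (v ^ i - 1) \<le> c" for i
    using vabs_power_diff_le[OF v, of 1 i] vc by simp
  then have "vabs (\<Sum>i<p. v ^ i - 1) \<le> c"
    by (rule vabs_sum_le[OF \<open>0 \<le> c\<close>])
  ultimately have "vabs (of_nat p + (\<Sum>i<p. v ^ i - 1)) \<le> c"
    by (rule vabs_add_le)
  also have "of_nat p + (\<Sum>i<p. v ^ i - 1) = (\<Sum>i<p. v ^ i)"
    unfolding sum_subtractf by simp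
  finally have "vabs (v - 1) * vabs (\<Sum>i<p. v ^ i) \<le> c ^ Suc N * c"
    using v1 \<open>0 \<le> c\<close> by (intro mult_mono) auto
  moreover have "q ^ p ^ Suc N = v ^ p"
    unfolding v_def power_mult[symmetric] by (simp add: mult.commute)
  ultimately show ?case
    by (simp add: power_diff_1_eq vabs_mult mult.commute)
qed (use assms in simp)

lemma vabs_of_nat_diff_le:
  assumes "[x = y] (mod p ^ N)"
  shows "vabs (of_nat x - of_nat y :: 'a) \<le> (1 / real p) ^ N"
proof -
  have "int p ^ N dvd int x - int y"
    using assms by (simp add: cong_iff_dvd_diff flip: cong_int_iff)
  then obtain k where k: "int x - int y = int p ^ N * k"
    by (elim dvdE)
  have "vabs (of_int k :: 'a) \<le> 1"
    using vabs_of_int[of k] p_gt_1 by (cases "k = 0") (simp_all add: divide_le_eq_1)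
  moreover have "of_nat x - of_nat y = (of_nat p ^ N * of_int k :: 'a)"
    using arg_cong[OF k, of "of_int :: int \<Rightarrow> 'a"] by simp
  ultimately show ?thesis
    by (simp add: vabs_mult vabs_power vabs_of_p mult_left_le)
qed

text \<open>For \<open>x = y + p ^ N * d\<close> the difference is \<open>q ^ y\<close> times the
  difference of the \<open>d\<close>-th powers of \<open>q ^ p ^ N\<close> and 1; the other order is
  symmetric.\<close>

lemma vabs_power_diff_cong_le:
  fixes q :: 'a
  assumes "vabs q \<le> 1" "[x = y] (mod p ^ N)"
  shows "vabs (q ^ x - q ^ y) \<le> vabs (q ^ p ^ N - 1)"
proof -
  have *: "vabs (q ^ x - q ^ y) \<le> vabs (q ^ p ^ N - 1)" if "[x = y] (mod p ^ N)" "y \<le> x" for x y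
  proof -
    have "p ^ N dvd x - y"
      using that cong_altdef_nat by blast
    then obtain d where "x - y = p ^ N * d"
      by (elim dvdE)
    with \<open>y \<le> x\<close> have "x = y + p ^ N * d"
      by simp
    then have "q ^ x - q ^ y = q ^ y * ((q ^ p ^ N) ^ d - 1 ^ d)"
      by (simp add: power_add power_mult right_diff_distrib)
    moreover have "vabs ((q ^ p ^ N) ^ d - 1 ^ d) \<le> vabs (q ^ p ^ N - 1)"
      using assms(1) by (intro vabs_power_diff_le) (simp_all add: vabs_power power_le_one)
    moreover have "vabs (q ^ y) \<le> 1"
      using assms(1) by (simp add: vabs_power power_le_one)
    ultimately show ?thesis
      using mult_mono[of "vabs (q ^ y)" 1 "vabs ((q ^ p ^ N) ^ d - 1 ^ d)" "vabs (q ^ p ^ N - 1)"]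
      by (simp only: vabs_mult mult_1 vabs_nonneg zero_le_one)
  qed
  show ?thesis
    using *[of x y] *[of y x] assms(2) by (cases "y \<le> x") (auto simp: vabs_minus_commute cong_sym)
qed

lemma padic_uniform_power_mult_power:
  fixes q :: 'a
  assumes q: "vabs (q - 1) < 1"
  shows "padic_uniform p r (\<lambda>z. q ^ (\<Sum>j=1..r. b j * (m j + f * z j)) *
    of_nat (\<Sum>j=1..r. a j * (m j + f * z j)) ^ n)"
  unfolding padic_uniform_def
proof (intro allI impI)
  fix e :: real assume "0 < e"
  \<comment> \<open>One ratio below 1 serves both factors of the integrand:
    \<open>vabs (q - 1)\<close> and \<open>1 / p\<close> govern the power of \<open>q\<close>, and
    \<open>1 / p\<close> the linear form.\<close>
  define c where "c = max (vabs (q - 1)) (1 / real p)"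
  have c: "vabs (q - 1) \<le> c" "1 / real p \<le> c" "0 \<le> c" "c < 1"
    using q p_gt_1 by (auto simp: c_def le_max_iff_disj)
  have q1: "vabs q \<le> 1"
    using q vabs_le_1_near_1[of q] by simp
  obtain N where N: "c ^ N < e"
    using real_arch_pow_inv[OF \<open>0 < e\<close> c(4)] by blast
  have "vabs (q ^ (\<Sum>j=1..r. b j * (m j + f * x j)) * of_nat (\<Sum>j=1..r. a j * (m j + f * x j)) ^ n -
      q ^ (\<Sum>j=1..r. b j * (m j + f * y j)) * of_nat (\<Sum>j=1..r. a j * (m j + f * y j)) ^ n) \<le> e"
    if xy: "\<forall>j\<in>{1..r}. [x j = y j] (mod p ^ N)" for x y
  proof -
    have cong: "[(\<Sum>j=1..r. d j * (m j + f * x j)) = (\<Sum>j=1..r. d j * (m j + f * y j))] (mod p ^ N)" for d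
      using xy by (intro cong_sum cong_mult cong_add cong_refl) auto
    have "vabs (q ^ p ^ N - 1) \<le> c ^ Suc N"
      using c by (intro vabs_power_p_power_le) auto
    also have "\<dots> \<le> c ^ N"
      using c by (intro power_decreasing) auto
    finally have "vabs (q ^ p ^ N - 1) \<le> e"
      using N by simp
    then have fst: "vabs (q ^ (\<Sum>j=1..r. b j * (m j + f * x j)) - q ^ (\<Sum>j=1..r. b j * (m j + f * y j))) \<le> e"
      using vabs_power_diff_cong_le[OF q1 cong] order_trans by blast
    have "(1 / real p) ^ N \<le> c ^ N"
      using c(2) by (intro power_mono) auto
    then have "vabs (of_nat (\<Sum>j=1..r. a j * (m j + f * x j)) - of_nat (\<Sum>j=1..r. a j * (m j + f * y j)) :: 'a) \<le> e"
      using vabs_of_nat_diff_le[OF cong, of a] N by linarith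
    then have snd: "vabs (of_nat (\<Sum>j=1..r. a j * (m j + f * x j)) ^ n -
        of_nat (\<Sum>j=1..r. a j * (m j + f * y j)) ^ n :: 'a) \<le> e"
      using vabs_power_diff_le[OF vabs_of_nat_le_1 vabs_of_nat_le_1] order_trans by blast
    show ?thesis
      by (rule vabs_diff_mult_le[where B = 1 and C = 1])
        (use fst snd q1 in \<open>simp_all add: vabs_power power_le_one vabs_of_nat_le_1 del: of_nat_sum of_nat_mult of_nat_add\<close>)
  qed
  then show "\<exists>N. \<forall>x y. (\<forall>j\<in>{1..r}. [x j = y j] (mod p ^ N)) \<longrightarrow>
      vabs (q ^ (\<Sum>j=1..r. b j * (m j + f * x j)) * of_nat (\<Sum>j=1..r. a j * (m j + f * x j)) ^ n -
        q ^ (\<Sum>j=1..r. b j * (m j + f * y j)) * of_nat (\<Sum>j=1..r. a j * (m j + f * y j)) ^ n) \<le> e"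
    by blast
qed

text \<open>The partial sums sample only natural arguments, where \<open>qpow\<close> is an ordinary
  power.\<close>

lemma q_Euler_poly_eq_alternating_limit:
  fixes q x :: 'a
  assumes "vabs (q - 1) < radius"
  shows "q_Euler_poly p q r a b n x = iterated_integral (alternating_limit p 1) r
    (\<lambda>z. q ^ (\<Sum>j=1..r. b j * z j) * (x + of_nat (\<Sum>j=1..r. a j * z j)) ^ n)"
  unfolding q_Euler_poly_def
proof (rule iterated_integral_transfer)
  show "fermionic_integral p g = alternating_limit p 1 (\<lambda>y. g (of_nat y))" for g :: "'a \<Rightarrow> 'a"
    by (simp add: fermionic_integral_def alternating_limit_def)
  fix y :: "nat \<Rightarrow> 'a" and z :: "nat \<Rightarrow> nat"
  assume "\<And>j. j \<in> {1..r} \<Longrightarrow> y j = of_nat (z j)"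
  then have "(\<Sum>j=1..r. of_nat (d j) * y j) = of_nat (\<Sum>j=1..r. d j * z j)" for d
    by simp
  then show "qpow q (\<Sum>j=1..r. of_nat (b j) * y j) * (x + (\<Sum>j=1..r. of_nat (a j) * y j)) ^ n =
      q ^ (\<Sum>j=1..r. b j * z j) * (x + of_nat (\<Sum>j=1..r. a j * z j)) ^ n"
    by (simp only: qpow_of_nat[OF assms])
qed

lemma gen_q_Euler_number_eq_alternating_limit:
  fixes q :: 'a
  assumes "vabs (q - 1) < radius" "dirichlet_character f chi"
  shows "gen_q_Euler_number p f chi q r a b n = iterated_integral (alternating_limit p f) r
    (\<lambda>z. (\<Prod>j=1..r. chi (int (z j))) * (q ^ (\<Sum>j=1..r. b j * z j) * of_nat (\<Sum>j=1..r. a j * z j) ^ n))"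
  unfolding gen_q_Euler_number_def
proof (rule iterated_integral_transfer)
  show "fermionic_integral_X p f g = alternating_limit p f (\<lambda>y. g (X_of_nat p f y))"
    for g :: "(nat \<Rightarrow> nat) \<Rightarrow> 'a"
    by (simp add: fermionic_integral_X_def alternating_limit_def)
  fix x :: "nat \<Rightarrow> nat \<Rightarrow> nat" and z :: "nat \<Rightarrow> nat"
  assume x: "\<And>j. j \<in> {1..r} \<Longrightarrow> x j = X_of_nat p f (z j)"
  have "0 < f"
    using assms(2) by (simp add: dirichlet_character_def)
  then have "(\<Sum>j=1..r. of_nat (d j) * X_to_Zp (x j)) = (of_nat (\<Sum>j=1..r. d j * z j) :: 'a)" for d
    using x p_gt_1 by (simp add: X_to_Zp_X_of_nat)
  moreover have "(\<Prod>j=1..r. X_char chi (x j)) = (\<Prod>j=1..r. chi (int (z j)))"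
    using x by (intro prod.cong refl) (simp add: X_char_def X_of_nat_def dirichlet_character_mod[OF assms(2)])
  ultimately show "(\<Prod>j=1..r. X_char chi (x j)) * qpow q (\<Sum>j=1..r. of_nat (b j) * X_to_Zp (x j)) *
      (\<Sum>j=1..r. of_nat (a j) * X_to_Zp (x j)) ^ n =
      (\<Prod>j=1..r. chi (int (z j))) * (q ^ (\<Sum>j=1..r. b j * z j) * of_nat (\<Sum>j=1..r. a j * z j) ^ n)"
    by (simp only: qpow_of_nat[OF assms(1)] mult.assoc)
qed

end

theorem theorem1:
  fixes p r f n :: nat and a b :: "nat \<Rightarrow> nat"
    and q :: "'a::nonarch_field" and chi :: "int \<Rightarrow> 'a"
  assumes "prime p" and "odd p"
    and "is_Cp p TYPE('a)"
    and "vabs (q - 1) < real p powr (- 1 / (real p - 1))"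
    and "1 \<le> r"
    and "\<And>j. j \<in> {1..r} \<Longrightarrow> 0 < a j \<and> 0 < b j"
    and "0 < f" and "odd f"
    and "0 < n" and "odd n"
    and "dirichlet_character f chi" and "conductor f chi = f"
  shows "gen_q_Euler_number p f chi q r a b n =
    of_nat f ^ n *
      (\<Sum>m \<in> {1..r} \<rightarrow>\<^sub>E {0..f - 1}.
         (-1) ^ (\<Sum>j=1..r. m j) * (\<Prod>j=1..r. chi (int (m j))) * q ^ (\<Sum>j=1..r. b j * m j) *
         q_Euler_poly p (q ^ f) r a b n ((\<Sum>j=1..r. of_nat (a j * m j)) / of_nat f))"
proof -
  interpret padic_complete_field p "TYPE('a)"
    using assms(1,3) by unfold_locales (simp_all add: is_Cp_def)
  let ?I = "iterated_integral (alternating_limit p 1 :: (nat \<Rightarrow> 'a) \<Rightarrow> 'a) r"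
  \<comment> \<open>The integrand without its character factor, restricted to the class of
    \<open>m\<close> modulo \<open>f\<close>.\<close>
  define G where "G m z = q ^ (\<Sum>j=1..r. b j * (m j + f * z j)) *
    of_nat (\<Sum>j=1..r. a j * (m j + f * z j)) ^ n" for m z :: "nat \<Rightarrow> nat"
  have q: "vabs (q - 1) < radius"
    using assms(4) by (simp add: radius_def)
  then have q1: "vabs (q - 1) < 1"
    using radius_less_1 by simp
  then have "q \<noteq> 0"
    by auto
  \<comment> \<open>The parameter \<open>q ^ f\<close> stays in the disc where \<open>qpow\<close>
    at natural arguments is a power, so the polynomials on the right can be rewritten too.\<close>
  have qf: "vabs (q ^ f - 1) < radius"
    using vabs_power_diff_le[of q 1 f] vabs_le_1_near_1[of q] q q1 by simp
  have G: "padic_uniform p r (G m)" for m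
    unfolding G_def[abs_def] by (rule padic_uniform_power_mult_power[OF q1])
  \<comment> \<open>On a residue class modulo \<open>f\<close> the character product is constant, so
    there the full integrand is a constant multiple of \<open>G m\<close> and inherits its
    uniformity.\<close>
  have chi: "(\<Prod>j=1..r. chi (int (m j + f * z j))) = (\<Prod>j=1..r. chi (int (m j)))"
    for m z :: "nat \<Rightarrow> nat"
    by (simp only: dirichlet_character_add_mult[OF assms(11)])
  have "gen_q_Euler_number p f chi q r a b n =
      (\<Sum>m\<in>{1..r} \<rightarrow>\<^sub>E {..<f}. (-1) ^ (\<Sum>j=1..r. m j) * ?I (\<lambda>z. (\<Prod>j=1..r. chi (int (m j))) * G m z))"
    unfolding gen_q_Euler_number_eq_alternating_limit[OF q assms(11)]
    by (subst iterated_alternating_limit_split[OF assms(2,8)])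
      (simp_all only: chi padic_uniform_cmult[OF G, unfolded G_def] G_def)
  also have "{..<f} = {0..f - 1}"
    using \<open>0 < f\<close> by auto
  also have "(\<Sum>m\<in>{1..r} \<rightarrow>\<^sub>E {0..f - 1}. (-1) ^ (\<Sum>j=1..r. m j) * ?I (\<lambda>z. (\<Prod>j=1..r. chi (int (m j))) * G m z)) =
      (\<Sum>m\<in>{1..r} \<rightarrow>\<^sub>E {0..f - 1}. of_nat f ^ n * ((-1) ^ (\<Sum>j=1..r. m j) * (\<Prod>j=1..r. chi (int (m j))) *
        q ^ (\<Sum>j=1..r. b j * m j) * q_Euler_poly p (q ^ f) r a b n ((\<Sum>j=1..r. of_nat (a j * m j)) / of_nat f)))"
  proof (intro sum.cong refl)
    fix m :: "nat \<Rightarrow> nat"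
    \<comment> \<open>Everything independent of \<open>z\<close>: the exponent of \<open>q\<close>
      splits off \<open>\<Sum>j=1..r. b j * m j\<close>, and \<open>f\<close> comes out of the
      linear form \<open>n\<close> times.\<close>
    define C where "C = q ^ (\<Sum>j=1..r. b j * m j) * of_nat f ^ n"
    have "C \<noteq> 0"
      using \<open>q \<noteq> 0\<close> \<open>0 < f\<close> by (simp add: C_def)
    \<comment> \<open>The integrand of the polynomial is expressed through \<open>G m\<close>, for
      which uniformity is established, so that the constant \<open>inverse C\<close> may be moved
      out of the integral.\<close>
    have "(q ^ f) ^ (\<Sum>j=1..r. b j * z j) *
        ((\<Sum>j=1..r. of_nat (a j * m j)) / of_nat f + of_nat (\<Sum>j=1..r. a j * z j)) ^ n = inverse C * G m z" for z
    proof -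
      have split: "(\<Sum>j=1..r. d j * (m j + f * z j)) = (\<Sum>j=1..r. d j * m j) + f * (\<Sum>j=1..r. d j * z j)" for d
        by (simp add: distrib_left sum.distrib sum_distrib_left mult.left_commute)
      have "of_nat (\<Sum>j=1..r. a j * (m j + f * z j)) =
          of_nat f * ((\<Sum>j=1..r. of_nat (a j * m j)) / of_nat f + (of_nat (\<Sum>j=1..r. a j * z j) :: 'a))"
        unfolding split using \<open>0 < f\<close> by (simp add: distrib_left)
      then have "G m z = C * ((q ^ f) ^ (\<Sum>j=1..r. b j * z j) *
          ((\<Sum>j=1..r. of_nat (a j * m j)) / of_nat f + of_nat (\<Sum>j=1..r. a j * z j)) ^ n)"
        unfolding G_def split[of b] by (simp only: power_mult_distrib power_add power_mult C_def mult_ac)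
      with \<open>C \<noteq> 0\<close> show ?thesis by simp
    qed
    then have "q_Euler_poly p (q ^ f) r a b n ((\<Sum>j=1..r. of_nat (a j * m j)) / of_nat f) = inverse C * ?I (G m)"
      unfolding q_Euler_poly_eq_alternating_limit[OF qf]
      by (simp only: iterated_alternating_limit_cmult[OF assms(2) G])
    then have "?I (G m) = C * q_Euler_poly p (q ^ f) r a b n ((\<Sum>j=1..r. of_nat (a j * m j)) / of_nat f)"
      using \<open>C \<noteq> 0\<close> by simp
    then show "(-1) ^ (\<Sum>j=1..r. m j) * ?I (\<lambda>z. (\<Prod>j=1..r. chi (int (m j))) * G m z) =
        of_nat f ^ n * ((-1) ^ (\<Sum>j=1..r. m j) * (\<Prod>j=1..r. chi (int (m j))) *
          q ^ (\<Sum>j=1..r. b j * m j) * q_Euler_poly p (q ^ f) r a b n ((\<Sum>j=1..r. of_nat (a j * m j)) / of_nat f))"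
      unfolding iterated_alternating_limit_cmult[OF assms(2) G] C_def by (simp only: mult_ac)
  qed
  finally show ?thesis
    by (simp only: sum_distrib_left)
qed

end
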